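(* Let $p\ge 1$ and $q\ge 0$ be integers, and let $$X^+_{p,q}=\{x\in\mathbb{R}^{p+q} : x_1^2+\cdots+x_p^2-x_{p+1}^2-\cdots-x_{p+q}^2=1\}.$$ Then: (0) $X^+_{p,q}$ is path-connected if $p\ne 1$, and has exactly two path components if $p=1$; (1) for every basepoint, $\pi_1(X^+_{p,q})=0$ if $p\neq 2$ and $\pi_1(X^+_{p,q})\cong\mathbb{Z}$ if $p=2$; (2) for every basepoint, $\pi_2(X^+_{p,q})=0$ if $p\neq 3$ and $\pi_2(X^+_{p,q})\cong\mathbb{Z}$ if $p=3$.
   Context: $X^+_{p,q}$ (called a quasi-sphere) carries the subspace topology from $\mathbb{R}^{p+q}$. *)

theory Defs
  imports "HOL-Analysis.Analysis" "HOL-Algebra.Elementary_Groups"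
begin

(* The library's Euclidean_space n is R^n realised as the sequences vanishing from index n on,
   so the coordinates x_1, ..., x_n are x 0, ..., x (n - 1). *)
definition quasi_sphere :: "nat \<Rightarrow> nat \<Rightarrow> (nat \<Rightarrow> real) topology"
  where "quasi_sphere p q =
    subtopology (Euclidean_space (p + q))
      {x. (\<Sum>i\<in>{..<p}. (x i)\<^sup>2) - (\<Sum>i\<in>{p..<p + q}. (x i)\<^sup>2) = 1}"

definition unit_cube :: "nat \<Rightarrow> (nat \<Rightarrow> real) topology"
  where "unit_cube n = subtopology (Euclidean_space n) {x. \<forall>i<n. x i \<in> {0..1}}"

definition cube_boundary :: "nat \<Rightarrow> (nat \<Rightarrow> real) set"
  where "cube_boundary n = {x \<in> topspace (unit_cube n). \<exists>i<n. x i = 0 \<or> x i = 1}"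

definition spheroids :: "nat \<Rightarrow> 'a topology \<Rightarrow> 'a \<Rightarrow> ((nat \<Rightarrow> real) \<Rightarrow> 'a) set"
  where "spheroids n X a =
    {f. continuous_map (unit_cube n) X f \<and> (\<forall>x\<in>cube_boundary n. f x = a)}"

(* Homotopy relative to the boundary. Maps are total functions, but their values outside the
   cube are irrelevant here: spheroids agreeing on the cube lie in the same class. *)
definition spheroid_class ::
    "nat \<Rightarrow> 'a topology \<Rightarrow> 'a \<Rightarrow> ((nat \<Rightarrow> real) \<Rightarrow> 'a) \<Rightarrow> ((nat \<Rightarrow> real) \<Rightarrow> 'a) set"
  where "spheroid_class n X a f =
    {g. homotopic_with (\<lambda>h. \<forall>x\<in>cube_boundary n. h x = a) (unit_cube n) X f g}"

definition spheroid_concat ::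
    "((nat \<Rightarrow> real) \<Rightarrow> 'a) \<Rightarrow> ((nat \<Rightarrow> real) \<Rightarrow> 'a) \<Rightarrow> (nat \<Rightarrow> real) \<Rightarrow> 'a"
  where "spheroid_concat f g x =
    (if x 0 \<le> 1/2 then f (x(0 := 2 * x 0)) else g (x(0 := 2 * x 0 - 1)))"

(* The homotopy group pi_n(X, a), meaningful for n \<ge> 1. The union in the product ranges over all
   choices of representatives; the class does not depend on the choice. *)
definition homotopy_group ::
    "nat \<Rightarrow> 'a topology \<Rightarrow> 'a \<Rightarrow> ((nat \<Rightarrow> real) \<Rightarrow> 'a) set monoid"
  where "homotopy_group n X a =
    \<lparr>carrier = spheroid_class n X a ` spheroids n X a,
     monoid.mult = (\<lambda>A B. \<Union>f\<in>A. \<Union>g\<in>B. spheroid_class n X a (spheroid_concat f g)),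
     one = spheroid_class n X a (\<lambda>_. a)\<rparr>"

end

theory Submission
  imports Defs "HOL-Complex_Analysis.Riemann_Mapping"
begin

text \<open>
  The quasi-sphere is homeomorphic to \<open>S\<^sup>p\<^sup>-\<^sup>1 \<times> \<real>\<^sup>q\<close>: the first block of a point never vanishes, the second
  block is arbitrary and determines the length of the first. So only the direction of the first
  block matters, and a homotopy of spheroids may be prescribed as a nowhere vanishing map into \<open>\<real>\<^sup>p\<close>
  that has the right directions on the boundary of the cylinder over the cube
  (\<open>spheroid_homotopicI\<close>).

  If \<open>p > n + 1\<close>, such a map extends from the boundary of the \<open>(n + 1)\<close>-dimensional cylinder to the
  whole of it for reasons of dimension (\<open>extend_nonzero_coordinates\<close>). This makes \<open>\<pi>\<^sub>n\<close> trivial, and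
  the case of a segment gives path-connectedness for \<open>p \<ge> 2\<close>. If \<open>p = 1\<close>, the sign of the first
  coordinate separates two components, in each of which straight lines are homotopies. If \<open>p = 2\<close>,
  a map of a square to the punctured plane has a logarithm and can be contracted linearly there, so
  \<open>\<pi>\<^sub>2\<close> is trivial.

  The two infinite cyclic groups come from an integer-valued complete invariant that is additive and
  onto (\<open>homotopy_group_iso_integer_groupI\<close>). For \<open>\<pi>\<^sub>1\<close> and \<open>p = 2\<close> it is the winding number about
  the origin. For \<open>\<pi>\<^sub>2\<close> and \<open>p = 3\<close> it comes from the Hopf map from the nonzero vectors of \<open>\<complex>\<^sup>2\<close> to
  those of \<open>\<real>\<^sup>3\<close>, as the boundary homomorphism of its long exact sequence. A spheroid lifts through
  the Hopf map to a map of the square that is constant on three sides (\<open>hopf_lifting\<close>); the fourth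
  side then runs around the fibre over the base point, a punctured complex line, and the invariant is
  its winding number. It is well defined because homotopies lift as well (\<open>top_loop_homotopic\<close>). It is
  complete, and takes every value, because a nowhere vanishing map into \<open>\<complex>\<^sup>2 = \<real>\<^sup>4\<close> extends from the
  boundary of a cube of dimension at most three (\<open>extend_nonzero_map\<close>, \<open>homotopic_of_top_loop\<close>,
  \<open>degree_surjective\<close>). Concatenating spheroids concatenates lifts, because these agree on
  the common side (\<open>degree_concat\<close>).
\<close>

section \<open>Homotopy groups through a complete invariant\<close>

abbreviation spheroid_homotopic ::
    "nat \<Rightarrow> 'a topology \<Rightarrow> 'a \<Rightarrow> ((nat \<Rightarrow> real) \<Rightarrow> 'a) \<Rightarrow> ((nat \<Rightarrow> real) \<Rightarrow> 'a) \<Rightarrow> bool"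
  where "spheroid_homotopic n X a \<equiv>
    homotopic_with (\<lambda>h. \<forall>x\<in>cube_boundary n. h x = a) (unit_cube n) X"

lemma continuous_map_into_Euclidean_subspace:
  "continuous_map Y (subtopology (Euclidean_space m) S) f \<longleftrightarrow>
    (\<forall>i. continuous_map Y euclideanreal (\<lambda>y. f y i)) \<and>
    f \<in> topspace Y \<rightarrow> topspace (subtopology (Euclidean_space m) S)"
  by (auto simp: Euclidean_space_def continuous_map_in_subtopology continuous_map_componentwise_UNIV
      image_subset_iff_funcset)

lemma topspace_unit_cube:
  "topspace (unit_cube n) = {x. (\<forall>i<n. 0 \<le> x i \<and> x i \<le> 1) \<and> (\<forall>i\<ge>n. x i = 0)}"
  by (auto simp: unit_cube_def topspace_Euclidean_space)

lemma continuous_map_into_unit_cube: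
  "continuous_map Y (unit_cube n) f \<longleftrightarrow>
    (\<forall>i. continuous_map Y euclideanreal (\<lambda>y. f y i)) \<and> f \<in> topspace Y \<rightarrow> topspace (unit_cube n)"
  unfolding unit_cube_def by (rule continuous_map_into_Euclidean_subspace)

lemma continuous_map_unit_cube_coordinate:
  "continuous_map (unit_cube n) euclideanreal (\<lambda>x. x i)"
  using continuous_map_into_unit_cube[of "unit_cube n" n "\<lambda>x. x"] by simp

lemma spheroid_concat_in_spheroids:
  assumes n: "n \<ge> 1" and f: "f \<in> spheroids n X a" and g: "g \<in> spheroids n X a"
  shows "spheroid_concat f g \<in> spheroids n X a"
proof -
  have half: "continuous_map (subtopology (unit_cube n) S) X (\<lambda>x. h (x(0 := 2 * x 0 - k)))"
    if "h \<in> spheroids n X a" "\<And>x. x \<in> topspace (unit_cube n) \<inter> S \<Longrightarrow> 0 \<le> 2 * x 0 - k \<and> 2 * x 0 - k \<le> 1"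
    for S h and k :: real
  proof -
    have "continuous_map (subtopology (unit_cube n) S) (unit_cube n) (\<lambda>x. x(0 := 2 * x 0 - k))"
      unfolding continuous_map_into_unit_cube
    proof (intro conjI allI)
      fix i
      have "continuous_map (unit_cube n) euclideanreal (\<lambda>x. if i = 0 then 2 * x 0 - k else x i)"
        by (cases "i = 0") (simp_all add: continuous_map_diff continuous_map_real_mult_left
            continuous_map_unit_cube_coordinate)
      moreover have "(\<lambda>x. (x(0 := 2 * x 0 - k)) i) = (\<lambda>x. if i = 0 then 2 * x 0 - k else x i)"
        by auto
      ultimately show "continuous_map (subtopology (unit_cube n) S) euclideanreal (\<lambda>x. (x(0 := 2 * x 0 - k)) i)"
        by (simp add: continuous_map_from_subtopology)
    qed (use n that in \<open>auto simp: topspace_unit_cube\<close>)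
    then have "continuous_map (subtopology (unit_cube n) S) X (h \<circ> (\<lambda>x. x(0 := 2 * x 0 - k)))"
      using that(1) by (intro continuous_map_compose) (auto simp: spheroids_def)
    then show ?thesis by (simp add: o_def)
  qed
  have bd: "h (x(0 := s)) = a"
    if "h \<in> spheroids n X a" "x \<in> topspace (unit_cube n)" "s = 0 \<or> s = 1 \<or> (0 \<le> s \<and> s \<le> 1 \<and> (\<exists>i. 0 < i \<and> i < n \<and> (x i = 0 \<or> x i = 1)))"
    for h and x :: "nat \<Rightarrow> real" and s
  proof -
    have "x(0 := s) \<in> cube_boundary n"
      unfolding cube_boundary_def topspace_unit_cube using that n 
      by (auto simp: topspace_unit_cube intro: exI[of _ "0::nat"]) (metis less_irrefl)+
    then show ?thesis using that(1) by (auto simp: spheroids_def)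
  qed
  have "continuous_map (unit_cube n) X (spheroid_concat f g)"
    unfolding spheroid_concat_def[abs_def]
  proof (rule continuous_map_cases_le)
    show "continuous_map (subtopology (unit_cube n) {x \<in> topspace (unit_cube n). x 0 \<le> 1/2}) X
        (\<lambda>x. f (x(0 := 2 * x 0)))"
      using half[OF f, where k = 0 and S = "{x \<in> topspace (unit_cube n). x 0 \<le> 1/2}"] n
      by (simp add: topspace_unit_cube)
    show "continuous_map (subtopology (unit_cube n) {x \<in> topspace (unit_cube n). 1/2 \<le> x 0}) X
        (\<lambda>x. g (x(0 := 2 * x 0 - 1)))"
      using half[OF g, where k = 1 and S = "{x \<in> topspace (unit_cube n). 1/2 \<le> x 0}"] n
      by (simp add: topspace_unit_cube)
    show "f (x(0 := 2 * x 0)) = g (x(0 := 2 * x 0 - 1))"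
      if "x \<in> topspace (unit_cube n)" "x 0 = 1/2" for x
      using bd[OF f that(1)] bd[OF g that(1)] that(2) by simp
  qed (auto intro: continuous_map_unit_cube_coordinate)
  moreover have "spheroid_concat f g x = a" if x: "x \<in> cube_boundary n" for x
  proof -
    have xt: "x \<in> topspace (unit_cube n)" using x by (simp add: cube_boundary_def)
    obtain i where i: "i < n" "x i = 0 \<or> x i = 1" using x by (auto simp: cube_boundary_def)
    have "0 \<le> x 0" "x 0 \<le> 1" using xt n by (auto simp: topspace_unit_cube)
    moreover have "x 0 = 0 \<or> x 0 = 1 \<or> (\<exists>i. 0 < i \<and> i < n \<and> (x i = 0 \<or> x i = 1))"
      using i by (cases "i = 0") auto
    ultimately show ?thesis
      by (cases "x 0 \<le> 1/2") (auto simp: spheroid_concat_def intro: bd[OF f xt] bd[OF g xt])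
  qed
  ultimately show ?thesis by (simp add: spheroids_def)
qed

lemma spheroid_homotopic_imp_spheroids:
  "spheroid_homotopic n X a f g \<Longrightarrow> f \<in> spheroids n X a \<and> g \<in> spheroids n X a"
  using homotopic_with_imp_continuous_maps[of _ "unit_cube n" X f g]
    homotopic_with_imp_property[of _ "unit_cube n" X f g]
  by (simp add: spheroids_def)

lemma const_in_spheroids: "a \<in> topspace X \<Longrightarrow> (\<lambda>_. a) \<in> spheroids n X a"
  by (simp add: spheroids_def)

lemma spheroid_class_cong:
  assumes "spheroid_homotopic n X a f g"
  shows "spheroid_class n X a f = spheroid_class n X a g"
  unfolding spheroid_class_def using homotopic_with_trans[OF assms]
    homotopic_with_trans[OF homotopic_with_symD[OF assms]] by blast

lemma spheroid_class_self: "f \<in> spheroids n X a \<Longrightarrow> f \<in> spheroid_class n X a f"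
  by (simp add: spheroid_class_def spheroids_def)

lemma trivial_homotopy_groupI:
  assumes n: "n \<ge> 1" and a: "a \<in> topspace X"
    and null: "\<And>f. f \<in> spheroids n X a \<Longrightarrow> spheroid_homotopic n X a f (\<lambda>_. a)"
  shows "trivial_group (homotopy_group n X a)"
proof -
  let ?G = "homotopy_group n X a" and ?e = "spheroid_class n X a (\<lambda>_. a)"
  have one: "\<one>\<^bsub>?G\<^esub> = ?e" by (simp add: homotopy_group_def)
  have carrier: "carrier ?G = {?e}"
    unfolding homotopy_group_def partial_object.simps
    using const_in_spheroids[OF a] spheroid_class_cong[OF null] by blast
  have "?e \<otimes>\<^bsub>?G\<^esub> ?e = (\<Union>f\<in>?e. \<Union>g\<in>?e. spheroid_class n X a (spheroid_concat f g))"
    by (simp add: homotopy_group_def)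
  also have "\<dots> = (\<Union>f\<in>?e. \<Union>g\<in>?e. ?e)"
  proof (intro SUP_cong refl)
    fix f g assume "f \<in> ?e" "g \<in> ?e"
    then have "f \<in> spheroids n X a" "g \<in> spheroids n X a"
      by (auto simp: spheroid_class_def dest: spheroid_homotopic_imp_spheroids)
    then show "spheroid_class n X a (spheroid_concat f g) = ?e"
      using n by (intro spheroid_class_cong null spheroid_concat_in_spheroids)
  qed
  also have "\<dots> = ?e"
    using spheroid_class_self[OF const_in_spheroids[OF a]] by blast
  finally have mult: "?e \<otimes>\<^bsub>?G\<^esub> ?e = ?e" .
  have "group ?G"
    by (rule groupI) (auto simp: carrier one mult)
  then show ?thesis by (simp add: trivial_group_def carrier one)
qed

text \<open>The invariant identifies the classes with the integers, and additivity makes this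
  identification multiplicative.\<close>

lemma homotopy_group_iso_integer_groupI:
  fixes D :: "((nat \<Rightarrow> real) \<Rightarrow> 'a) \<Rightarrow> int"
  assumes n: "n \<ge> 1"
    and complete: "\<And>f g. \<lbrakk>f \<in> spheroids n X a; g \<in> spheroids n X a\<rbrakk>
                     \<Longrightarrow> spheroid_homotopic n X a f g \<longleftrightarrow> D f = D g"
    and surj: "\<And>k. \<exists>f\<in>spheroids n X a. D f = k"
    and add: "\<And>f g. \<lbrakk>f \<in> spheroids n X a; g \<in> spheroids n X a\<rbrakk>
                     \<Longrightarrow> D (spheroid_concat f g) = D f + D g"
  shows "homotopy_group n X a \<cong> integer_group"
proof -
  let ?G = "homotopy_group n X a" and ?C = "spheroid_class n X a"
  have cls: "g \<in> ?C f \<longleftrightarrow> g \<in> spheroids n X a \<and> D g = D f" if "f \<in> spheroids n X a" for f g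
    using complete[OF that, of g] spheroid_homotopic_imp_spheroids[of n a X f g]
    by (auto simp: spheroid_class_def)
  define \<phi> where "\<phi> A = D (SOME f. f \<in> A)" for A
  have \<phi>: "\<phi> (?C f) = D f" if "f \<in> spheroids n X a" for f
    unfolding \<phi>_def by (metis cls spheroid_class_self someI_ex that)
  have mult: "?C f \<otimes>\<^bsub>?G\<^esub> ?C g = ?C (spheroid_concat f g)"
    if f: "f \<in> spheroids n X a" and g: "g \<in> spheroids n X a" for f g
  proof -
    have "?C f \<otimes>\<^bsub>?G\<^esub> ?C g = (\<Union>f'\<in>?C f. \<Union>g'\<in>?C g. ?C (spheroid_concat f' g'))"
      by (simp add: homotopy_group_def)
    \<comment> \<open>Additivity shows that the class of a concatenation does not depend on the representatives.\<close>
    also have "\<dots> = (\<Union>f'\<in>?C f. \<Union>g'\<in>?C g. ?C (spheroid_concat f g))"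
      using n f g add complete
      by (intro SUP_cong refl spheroid_class_cong) (auto simp: cls spheroid_concat_in_spheroids)
    also have "\<dots> = ?C (spheroid_concat f g)"
      using spheroid_class_self[OF f] spheroid_class_self[OF g] by blast
    finally show ?thesis .
  qed
  have "\<phi> \<in> hom ?G integer_group"
  proof (rule homI)
    fix A B assume "A \<in> carrier ?G" "B \<in> carrier ?G"
    then obtain f g where "f \<in> spheroids n X a" "A = ?C f" "g \<in> spheroids n X a" "B = ?C g"
      by (auto simp: homotopy_group_def)
    then show "\<phi> (A \<otimes>\<^bsub>?G\<^esub> B) = \<phi> A \<otimes>\<^bsub>integer_group\<^esub> \<phi> B"
      using n by (simp add: mult \<phi> spheroid_concat_in_spheroids add)
  qed simp
  moreover have "bij_betw \<phi> (carrier ?G) (carrier integer_group)"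
  proof (rule bij_betw_imageI)
    show "inj_on \<phi> (carrier ?G)"
    proof (rule inj_onI)
      fix A B assume "A \<in> carrier ?G" "B \<in> carrier ?G" and eq: "\<phi> A = \<phi> B"
      then obtain f g where "f \<in> spheroids n X a" "A = ?C f" "g \<in> spheroids n X a" "B = ?C g"
        by (auto simp: homotopy_group_def)
      then show "A = B"
        using eq complete spheroid_class_cong[of n a X f g] by (simp add: \<phi>)
    qed
    show "\<phi> ` carrier ?G = carrier integer_group"
    proof (intro equalityI subsetI)
      fix k :: int
      obtain f where "f \<in> spheroids n X a" "D f = k" using surj by blast
      then show "k \<in> \<phi> ` carrier ?G"
        using \<phi>[of f] by (intro rev_image_eqI[of "?C f"]) (simp_all add: homotopy_group_def)
    qed simp
  qed
  ultimately show ?thesis by (auto simp: is_iso_def iso_def)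
qed

section \<open>Splitting off the contractible factor\<close>

text \<open>The homeomorphism of \<open>S\<^sup>p\<^sup>-\<^sup>1 \<times> \<real>\<^sup>q\<close> onto the quasi-sphere, with the unit sphere replaced by all
  nonzero vectors \<open>z\<close>: the vector is rescaled to the length that the second block \<open>y\<close> requires. On all
  of \<open>(\<real>\<^sup>p - {0}) \<times> \<real>\<^sup>q\<close> this is a retraction onto the quasi-sphere.\<close>
definition quasi_point :: "nat \<Rightarrow> nat \<Rightarrow> (nat \<Rightarrow> real) \<Rightarrow> (nat \<Rightarrow> real) \<Rightarrow> nat \<Rightarrow> real"
  where "quasi_point p q z y i =
    (if i < p then z i * (sqrt (1 + (\<Sum>j\<in>{p..<p+q}. (y j)\<^sup>2)) / sqrt (\<Sum>j<p. (z j)\<^sup>2))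
     else if i < p + q then y i else 0)"

lemma topspace_quasi_sphere:
  "topspace (quasi_sphere p q) =
    {x. (\<forall>i\<ge>p+q. x i = 0) \<and> (\<Sum>i<p. (x i)\<^sup>2) = 1 + (\<Sum>i\<in>{p..<p+q}. (x i)\<^sup>2)}"
  by (auto simp: quasi_sphere_def topspace_Euclidean_space)

lemma continuous_map_into_quasi_sphere:
  "continuous_map Y (quasi_sphere p q) f \<longleftrightarrow>
    (\<forall>i. continuous_map Y euclideanreal (\<lambda>y. f y i)) \<and> f \<in> topspace Y \<rightarrow> topspace (quasi_sphere p q)"
  unfolding quasi_sphere_def by (rule continuous_map_into_Euclidean_subspace)

lemma sum_squares_pos:
  fixes z :: "nat \<Rightarrow> real"
  shows "\<exists>i<p. z i \<noteq> 0 \<Longrightarrow> 0 < (\<Sum>i<p. (z i)\<^sup>2)"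
  by (auto intro: sum_pos2)

lemma quasi_sphere_nonzero:
  assumes "x \<in> topspace (quasi_sphere p q)"
  shows "\<exists>i<p. x i \<noteq> 0"
proof (rule ccontr)
  assume "\<not> ?thesis"
  then have "(\<Sum>i<p. (x i)\<^sup>2) = 0" by simp
  moreover have "0 \<le> (\<Sum>i\<in>{p..<p+q}. (x i)\<^sup>2)" by (simp add: sum_nonneg)
  ultimately show False using assms by (simp add: topspace_quasi_sphere)
qed

lemma quasi_point_in_quasi_sphere:
  assumes "\<exists>i<p. z i \<noteq> 0"
  shows "quasi_point p q z y \<in> topspace (quasi_sphere p q)"
proof -
  let ?y = "\<Sum>j\<in>{p..<p+q}. (y j)\<^sup>2" and ?z = "\<Sum>j<p. (z j)\<^sup>2"
  have "0 < ?z" by (rule sum_squares_pos[OF assms])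
  have "0 \<le> ?y" by (simp add: sum_nonneg)
  then have "(sqrt (1 + ?y) / sqrt ?z)\<^sup>2 = (1 + ?y) / ?z"
    using \<open>0 < ?z\<close> by (simp add: power_divide)
  then have "(\<Sum>i<p. (z i * (sqrt (1 + ?y) / sqrt ?z))\<^sup>2) = ?z * ((1 + ?y) / ?z)"
    by (simp only: power_mult_distrib sum_distrib_right)
  then have "(\<Sum>i<p. (z i * (sqrt (1 + ?y) / sqrt ?z))\<^sup>2) = 1 + ?y"
    using \<open>0 < ?z\<close> by simp
  then show ?thesis
    by (simp add: topspace_quasi_sphere quasi_point_def)
qed

text \<open>The first block only matters through its direction, so in what follows a map to the
  quasi-sphere may be prescribed up to a positive factor.\<close>

lemma quasi_point_eq:
  assumes x: "x \<in> topspace (quasi_sphere p q)" and r: "\<exists>r>0. \<forall>i<p. z i = r * x i"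
    and y: "\<And>i. \<lbrakk>p \<le> i; i < p + q\<rbrakk> \<Longrightarrow> y i = x i"
  shows "quasi_point p q z y = x"
proof
  fix i
  obtain r where r: "r > 0" "\<And>i. i < p \<Longrightarrow> z i = r * x i" using r by auto
  have "(\<Sum>j<p. (z j)\<^sup>2) = r\<^sup>2 * (\<Sum>j<p. (x j)\<^sup>2)"
    by (simp add: r power_mult_distrib sum_distrib_left)
  moreover have "(\<Sum>j\<in>{p..<p+q}. (y j)\<^sup>2) = (\<Sum>j\<in>{p..<p+q}. (x j)\<^sup>2)"
    by (simp add: y)
  moreover have "0 \<le> (\<Sum>j\<in>{p..<p+q}. (x j)\<^sup>2)" by (simp add: sum_nonneg)
  ultimately show "quasi_point p q z y i = x i"
    using x r y by (auto simp: quasi_point_def topspace_quasi_sphere real_sqrt_mult)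
qed

lemma quasi_point_direction:
  assumes "\<exists>i<p. z i \<noteq> 0"
  shows "\<exists>r>0. \<forall>i<p. quasi_point p q z y i = r * z i"
proof -
  have "0 < (\<Sum>i<p. (z i)\<^sup>2)" by (rule sum_squares_pos[OF assms])
  moreover have "0 \<le> (\<Sum>j\<in>{p..<p+q}. (y j)\<^sup>2)" by (simp add: sum_nonneg)
  ultimately show ?thesis
    by (intro exI[of _ "sqrt (1 + (\<Sum>j\<in>{p..<p+q}. (y j)\<^sup>2)) / sqrt (\<Sum>j<p. (z j)\<^sup>2)"])
      (auto simp: quasi_point_def)
qed

lemma continuous_map_quasi_point:
  assumes z: "\<And>i. i < p \<Longrightarrow> continuous_map Y euclideanreal (\<lambda>w. z w i)"
    and y: "\<And>i. \<lbrakk>p \<le> i; i < p + q\<rbrakk> \<Longrightarrow> continuous_map Y euclideanreal (\<lambda>w. y w i)"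
    and nz: "\<And>w. w \<in> topspace Y \<Longrightarrow> \<exists>i<p. z w i \<noteq> 0"
  shows "continuous_map Y (quasi_sphere p q) (\<lambda>w. quasi_point p q (z w) (y w))"
  unfolding continuous_map_into_quasi_sphere
proof (intro conjI allI)
  fix i
  have "(\<Sum>j<p. (z w j)\<^sup>2) \<noteq> 0" if "w \<in> topspace Y" for w
    using sum_squares_pos[OF nz[OF that]] by simp
  then have "continuous_map Y euclideanreal (\<lambda>w. z w i * (sqrt (1 + (\<Sum>j\<in>{p..<p+q}. (y w j)\<^sup>2)) / sqrt (\<Sum>j<p. (z w j)\<^sup>2)))"
    if "i < p"
    using that
    by (intro continuous_map_real_mult continuous_map_real_divide continuous_map_sqrt
        continuous_map_add continuous_map_sum continuous_map_real_pow z y) auto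
  then show "continuous_map Y euclideanreal (\<lambda>w. quasi_point p q (z w) (y w) i)"
    using y[of i] by (cases "i < p"; cases "i < p + q") (simp_all add: quasi_point_def)
qed (simp add: Pi_iff quasi_point_in_quasi_sphere nz)

section \<open>Spheroids in box coordinates\<close>

text \<open>The extension theorems below concern maps on boxes in Euclidean spaces that are types. A chart
  identifies the cube of sequences with such a box \<open>Q\<close>, and its boundary with \<open>bd\<close>.\<close>
locale cube_chart =
  fixes n :: nat and Q bd :: "'m::euclidean_space set" and lo hi :: 'm
    and c :: "'m \<Rightarrow> nat \<Rightarrow> real" and d :: "(nat \<Rightarrow> real) \<Rightarrow> 'm"
  assumes n: "n \<ge> 1" and Q: "Q = cbox lo hi"
    and c: "continuous_map (top_of_set Q) (unit_cube n) c"
    and d: "continuous_map (unit_cube n) (top_of_set Q) d"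
    and dc: "z \<in> Q \<Longrightarrow> d (c z) = z"
    and cd: "x \<in> topspace (unit_cube n) \<Longrightarrow> c (d x) = x"
    and bd: "closed bd" "bd \<subseteq> Q" "bd \<noteq> {}"
    and bd_iff: "z \<in> Q \<Longrightarrow> c z \<in> cube_boundary n \<longleftrightarrow> z \<in> bd"
begin

lemma d_in: "x \<in> topspace (unit_cube n) \<Longrightarrow> d x \<in> Q"
  using d by (auto simp: continuous_map_def)

lemma boundary_d: "x \<in> cube_boundary n \<Longrightarrow> x \<in> topspace (unit_cube n) \<and> d x \<in> bd"
  using bd_iff[of "d x"] d_in[of x] cd[of x] by (auto simp: cube_boundary_def)

lemma continuous_map_on_cylinder:
  assumes "continuous_on ({0..1::real} \<times> Q) (\<phi> :: real \<times> 'm \<Rightarrow> real)"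
  shows "continuous_map (prod_topology (top_of_set {0..1}) (unit_cube n)) euclideanreal (\<lambda>(t, x). \<phi> (t, d x))"
proof -
  have "continuous_map (prod_topology (top_of_set {0..1::real}) (unit_cube n)) (top_of_set ({0..1} \<times> Q)) (\<lambda>(t, x). (t, d x))"
    using d by (subst prod_topology_subtopology_eu[symmetric], subst continuous_map_prod_top) simp
  from continuous_map_compose[OF this, of euclideanreal \<phi>] assms
  show ?thesis by (simp add: o_def case_prod_unfold)
qed

text \<open>The map \<open>\<Phi>\<close> only prescribes directions of the first block. The second block, which lives
  in a vector space, is interpolated linearly, and \<open>quasi_point\<close> supplies the length of the first.\<close>

lemma spheroid_homotopicI:
  fixes \<Phi> :: "real \<times> 'm \<Rightarrow> nat \<Rightarrow> real"
  assumes f: "f \<in> spheroids n (quasi_sphere p q) a" and g: "g \<in> spheroids n (quasi_sphere p q) a"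
    and cont: "\<And>i. i < p \<Longrightarrow> continuous_on ({0..1} \<times> Q) (\<lambda>w. \<Phi> w i)"
    and nz: "\<And>w. w \<in> {0..1} \<times> Q \<Longrightarrow> \<exists>i<p. \<Phi> w i \<noteq> 0"
    and start: "\<And>z. z \<in> Q \<Longrightarrow> \<exists>r>0. \<forall>i<p. \<Phi> (0, z) i = r * f (c z) i"
    and finish: "\<And>z. z \<in> Q \<Longrightarrow> \<exists>r>0. \<forall>i<p. \<Phi> (1, z) i = r * g (c z) i"
    and side: "\<And>t z. \<lbrakk>0 \<le> t; t \<le> 1; z \<in> bd\<rbrakk> \<Longrightarrow> \<exists>r>0. \<forall>i<p. \<Phi> (t, z) i = r * a i"
  shows "spheroid_homotopic n (quasi_sphere p q) a f g"
proof -
  let ?X = "quasi_sphere p q" and ?C = "prod_topology (top_of_set {0..1::real}) (unit_cube n)"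
  define y where "y w i = (1 - fst w) * f (snd w) i + fst w * g (snd w) i" for w :: "real \<times> (nat \<Rightarrow> real)" and i
  define h where "h w = quasi_point p q (\<Phi> (fst w, d (snd w))) (y w)" for w
  have fX: "f x \<in> topspace ?X" "g x \<in> topspace ?X" if "x \<in> topspace (unit_cube n)" for x
    using f g that by (auto simp: spheroids_def continuous_map_def)
  have y: "continuous_map ?C euclideanreal (\<lambda>w. y w i)" for i
  proof -
    have "continuous_map ?C euclideanreal (\<lambda>w. f (snd w) i)" "continuous_map ?C euclideanreal (\<lambda>w. g (snd w) i)"
      using f g continuous_map_compose[OF continuous_map_snd, of "unit_cube n" euclideanreal _ "top_of_set {0..1::real}"]
      by (auto simp: spheroids_def continuous_map_into_quasi_sphere o_def)
    moreover have "continuous_map ?C euclideanreal fst"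
      using continuous_map_fst[of "top_of_set {0..1::real}" "unit_cube n"]
      by (simp add: continuous_map_in_subtopology)
    ultimately show ?thesis
      unfolding y_def by (intro continuous_map_add continuous_map_real_mult continuous_map_diff) auto
  qed
  show ?thesis
  proof (subst homotopic_with)
    show "(\<forall>x\<in>cube_boundary n. h x = a) = (\<forall>x\<in>cube_boundary n. k x = a)"
      if "\<And>x. x \<in> topspace (unit_cube n) \<Longrightarrow> h x = k x" for h k :: "(nat \<Rightarrow> real) \<Rightarrow> nat \<Rightarrow> real"
      using that by (auto simp: cube_boundary_def)
    show "\<exists>h. continuous_map ?C ?X h \<and>
        (\<forall>x\<in>topspace (unit_cube n). h (0, x) = f x) \<and> (\<forall>x\<in>topspace (unit_cube n). h (1, x) = g x) \<and>
        (\<forall>t\<in>{0..1}. \<forall>x\<in>cube_boundary n. h (t, x) = a)"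
    proof (intro exI[of _ h] conjI ballI)
      show "continuous_map ?C ?X h"
        unfolding h_def
        using continuous_map_on_cylinder[OF cont] y
        by (intro continuous_map_quasi_point nz) (auto simp: case_prod_unfold d_in)
    next
      fix x assume x: "x \<in> topspace (unit_cube n)"
      show "h (0, x) = f x" "h (1, x) = g x"
        unfolding h_def using start[OF d_in[OF x]] finish[OF d_in[OF x]] fX[OF x]
        by (auto intro!: quasi_point_eq simp: y_def cd[OF x])
    next
      fix t :: real and x assume t: "t \<in> {0..1}" and x: "x \<in> cube_boundary n"
      then have fa: "f x = a" "g x = a" "x \<in> topspace (unit_cube n)" using f g by (auto simp: spheroids_def cube_boundary_def)
      have "y (t, x) i = a i" for i by (simp add: y_def fa algebra_simps)
      then show "h (t, x) = a"
        unfolding h_def using side[of t "d x"] t boundary_d[OF x] fX[OF fa(3)] fa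
        by (intro quasi_point_eq) auto
    qed
  qed
qed

lemma spheroid_homotopicE:
  assumes "spheroid_homotopic n (quasi_sphere p q) a f g"
  obtains H :: "real \<times> 'm \<Rightarrow> nat \<Rightarrow> real"
  where "\<And>i. continuous_on ({0..1} \<times> Q) (\<lambda>w. H w i)"
    and "\<And>w. w \<in> {0..1} \<times> Q \<Longrightarrow> H w \<in> topspace (quasi_sphere p q)"
    and "\<And>z. z \<in> Q \<Longrightarrow> H (0, z) = f (c z)" and "\<And>z. z \<in> Q \<Longrightarrow> H (1, z) = g (c z)"
    and "\<And>t z. \<lbrakk>0 \<le> t; t \<le> 1; z \<in> bd\<rbrakk> \<Longrightarrow> H (t, z) = a"
proof -
  obtain h where h: "continuous_map (prod_topology (top_of_set {0..1::real}) (unit_cube n)) (quasi_sphere p q) h"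
    and h01: "\<And>x. h (0, x) = f x" "\<And>x. h (1, x) = g x"
    and hbd: "\<And>t x. \<lbrakk>t \<in> {0..1}; x \<in> cube_boundary n\<rbrakk> \<Longrightarrow> h (t, x) = a"
    using assms unfolding homotopic_with_def by blast
  have "continuous_map (top_of_set ({0..1::real} \<times> Q)) (prod_topology (top_of_set {0..1::real}) (unit_cube n)) (\<lambda>(t, z). (t, c z))"
    using c by (subst prod_topology_subtopology_eu[symmetric], subst continuous_map_prod_top) simp
  from continuous_map_compose[OF this h]
  have *: "continuous_map (top_of_set ({0..1} \<times> Q)) (quasi_sphere p q) (\<lambda>(t, z). h (t, c z))"
    by (simp add: o_def case_prod_unfold)
  show thesis
  proof (rule that[of "\<lambda>(t, z). h (t, c z)"])
    show "continuous_on ({0..1} \<times> Q) (\<lambda>w. (case w of (t, z) \<Rightarrow> h (t, c z)) i)" for i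
      using * by (auto simp: continuous_map_into_quasi_sphere)
    show "(case w of (t, z) \<Rightarrow> h (t, c z)) \<in> topspace (quasi_sphere p q)" if "w \<in> {0..1} \<times> Q" for w
      using * that by (auto simp: continuous_map_into_quasi_sphere Pi_iff)
  qed (use bd_iff bd h01 hbd in auto)
qed

lemma spheroid_coordinates:
  assumes "f \<in> spheroids n (quasi_sphere p q) a"
  shows "continuous_on Q (\<lambda>z. f (c z) i)" and "z \<in> Q \<Longrightarrow> f (c z) \<in> topspace (quasi_sphere p q)"
    and "z \<in> bd \<Longrightarrow> f (c z) = a"
proof -
  have *: "continuous_map (top_of_set Q) (quasi_sphere p q) (f \<circ> c)"
    using assms c by (intro continuous_map_compose) (auto simp: spheroids_def)
  then show "continuous_on Q (\<lambda>z. f (c z) i)" by (auto simp: continuous_map_into_quasi_sphere)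
  show "z \<in> Q \<Longrightarrow> f (c z) \<in> topspace (quasi_sphere p q)"
    using * by (auto simp: continuous_map_into_quasi_sphere)
  show "z \<in> bd \<Longrightarrow> f (c z) = a"
    using assms bd bd_iff[of z] by (auto simp: spheroids_def)
qed

text \<open>Keeping the second block of the base point throughout, any field of directions that is right on
  the boundary is realised by a spheroid.\<close>

lemma spheroid_with_directions:
  fixes \<Phi> :: "'m \<Rightarrow> nat \<Rightarrow> real"
  assumes a: "a \<in> topspace (quasi_sphere p q)"
    and cont: "\<And>i. i < p \<Longrightarrow> continuous_on Q (\<lambda>z. \<Phi> z i)"
    and nz: "\<And>z. z \<in> Q \<Longrightarrow> \<exists>i<p. \<Phi> z i \<noteq> 0"
    and side: "\<And>z. z \<in> bd \<Longrightarrow> \<exists>r>0. \<forall>i<p. \<Phi> z i = r * a i"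
  obtains f where "f \<in> spheroids n (quasi_sphere p q) a"
    and "\<And>z. z \<in> Q \<Longrightarrow> \<exists>r>0. \<forall>i<p. f (c z) i = r * \<Phi> z i"
proof
  let ?f = "\<lambda>x. quasi_point p q (\<Phi> (d x)) a"
  have "continuous_map (unit_cube n) euclideanreal (\<lambda>x. \<Phi> (d x) i)" if "i < p" for i
    using continuous_map_compose[OF d, of euclideanreal "\<lambda>z. \<Phi> z i"] cont[OF that] by (simp add: o_def)
  then have "continuous_map (unit_cube n) (quasi_sphere p q) ?f"
    by (intro continuous_map_quasi_point nz d_in) auto
  moreover have "?f x = a" if "x \<in> cube_boundary n" for x
    using boundary_d[OF that] side by (intro quasi_point_eq a) auto
  ultimately show "?f \<in> spheroids n (quasi_sphere p q) a" by (simp add: spheroids_def)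
  show "\<exists>r>0. \<forall>i<p. ?f (c z) i = r * \<Phi> z i" if "z \<in> Q" for z
    using quasi_point_direction[OF nz[OF that]] dc[OF that] by simp
qed

end

interpretation interval: cube_chart 1 "{0..1::real}" "{0, 1}" 0 1 "\<lambda>s i. if i = 0 then s else 0" "\<lambda>x. x 0"
proof
  show "continuous_map (top_of_set {0..1}) (unit_cube 1) (\<lambda>s i. if i = 0 then s else 0)"
    unfolding continuous_map_into_unit_cube
  proof (intro conjI allI)
    show "continuous_map (top_of_set {0..1}) euclideanreal (\<lambda>s::real. if i = 0 then s else 0)" for i :: nat
      by (cases "i = 0") auto
  qed (auto simp: topspace_unit_cube)
  show "continuous_map (unit_cube 1) (top_of_set {0..1}) (\<lambda>x. x 0)"
    by (auto simp: continuous_map_in_subtopology continuous_map_unit_cube_coordinate topspace_unit_cube)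
  show "(\<lambda>i. if i = 0 then x 0 else 0) = x" if "x \<in> topspace (unit_cube 1)" for x
    using that by (auto simp: topspace_unit_cube)
  show "(\<lambda>i. if i = 0 then z else 0) \<in> cube_boundary 1 \<longleftrightarrow> z \<in> {0, 1}" if "z \<in> {0..1}" for z :: real
    using that by (auto simp: cube_boundary_def topspace_unit_cube)
qed auto

abbreviation square_boundary :: "(real \<times> real) set"
  where "square_boundary \<equiv> {0, 1} \<times> {0..1} \<union> {0..1} \<times> {0, 1}"

interpretation square: cube_chart 2 "{0..1::real} \<times> {0..1::real}" square_boundary "(0, 0)" "(1, 1)"
  "\<lambda>(s, t) i. if i = 0 then s else if i = 1 then t else 0" "\<lambda>x. (x 0, x 1)"
proof
  have eq: "(\<lambda>z. (case z of (s, t) \<Rightarrow> \<lambda>i. if i = 0 then s else if i = 1 then t else 0) i)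
      = (if i = 0 then fst else if i = 1 then snd else (\<lambda>z. 0))" for i :: nat
    by (auto simp: case_prod_unfold)
  show "continuous_map (top_of_set ({0..1} \<times> {0..1})) (unit_cube 2)
      (\<lambda>(s, t) i. if i = 0 then s else if i = 1 then t else 0)"
    unfolding continuous_map_into_unit_cube
  proof (intro conjI allI)
    show "continuous_map (top_of_set ({0..1} \<times> {0..1})) euclideanreal
        (\<lambda>z. (case z of (s, t) \<Rightarrow> \<lambda>i. if i = 0 then s else if i = 1 then t else 0) i)" for i :: nat
      unfolding eq by (auto intro: continuous_on_fst continuous_on_snd continuous_on_id)
  qed (auto simp: topspace_unit_cube)
  show "continuous_map (unit_cube 2) (top_of_set ({0..1} \<times> {0..1})) (\<lambda>x. (x 0, x 1))"
    by (subst prod_topology_subtopology_eu[symmetric], subst continuous_map_paired)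
      (auto simp: continuous_map_in_subtopology continuous_map_unit_cube_coordinate topspace_unit_cube)
  show "(case (x 0, x 1) of (s, t) \<Rightarrow> \<lambda>i. if i = 0 then s else if i = 1 then t else 0) = x"
    if "x \<in> topspace (unit_cube 2)" for x
    using that by (auto simp: topspace_unit_cube fun_eq_iff less_2_cases_iff) 
  show "(case z of (s, t) \<Rightarrow> \<lambda>i. if i = 0 then s else if i = 1 then t else 0) \<in> cube_boundary 2 \<longleftrightarrow>
      z \<in> square_boundary" if "z \<in> {0..1} \<times> {0..1}" for z :: "real \<times> real"
    using that by (auto simp: cube_boundary_def topspace_unit_cube less_2_cases_iff)
qed (auto simp: closed_Times cbox_Pair_eq)

section \<open>Extension of nowhere vanishing maps\<close>

text \<open>The direction is a map into a sphere of dimension at least that of the box, so it extends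
  to the box. The length extends as well, because its logarithm is a real function and
  Tietze's theorem applies.\<close>

lemma extend_nonzero_map:
  fixes f :: "'m::euclidean_space \<Rightarrow> 'n::euclidean_space"
  assumes dim: "DIM('m) < DIM('n)" and S: "closed S" "S \<subseteq> cbox lo hi"
    and f: "continuous_on S f" and nz: "\<And>x. x \<in> S \<Longrightarrow> f x \<noteq> 0"
  obtains g where "continuous_on (cbox lo hi) g" and "\<And>x. x \<in> cbox lo hi \<Longrightarrow> g x \<noteq> 0"
    and "\<And>x. x \<in> S \<Longrightarrow> g x = f x"
proof -
  have cont: "continuous_on S (\<lambda>x. f x /\<^sub>R norm (f x))" "continuous_on S (\<lambda>x. ln (norm (f x)))"
    using nz by (auto intro!: continuous_intros f)
  have aff: "aff_dim (cbox lo hi) < aff_dim (cball (0::'n) 1)"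
    using aff_dim_le_DIM[of "cbox lo hi"] dim by (simp add: aff_dim_cball)
  have sphere: "rel_frontier (cball (0::'n) 1) = sphere 0 1" by simp
  have "\<exists>u. continuous_on (cbox lo hi) u \<and> u \<in> cbox lo hi \<rightarrow> sphere (0::'n) 1 \<and>
      (\<forall>x\<in>S. u x = f x /\<^sub>R norm (f x))"
  proof (rule extend_map_cell_complex_to_sphere[of "{cbox lo hi}" S "cball (0::'n) 1" "\<lambda>x. f x /\<^sub>R norm (f x)"])
    show "(\<lambda>x. f x /\<^sub>R norm (f x)) \<in> S \<rightarrow> rel_frontier (cball 0 1)"
      unfolding sphere using nz by auto
    show "aff_dim X < aff_dim (cball (0::'n) 1)" if "X \<in> {cbox lo hi}" for X
      using aff that by simp
    show "polytope X" if "X \<in> {cbox lo hi}" for X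
      using that polytope_interval by simp
    show "X \<inter> Y face_of X" if "X \<in> {cbox lo hi}" "Y \<in> {cbox lo hi}" for X Y
      using that by (simp add: face_of_refl)
    show ?thesis if "continuous_on (\<Union> {cbox lo hi}) g" "g \<in> \<Union> {cbox lo hi} \<rightarrow> rel_frontier (cball 0 1)"
      "\<And>x. x \<in> S \<Longrightarrow> g x = f x /\<^sub>R norm (f x)" for g
      using that unfolding sphere by (intro exI[of _ g]) simp
  qed (use S cont in simp_all)
  then obtain u where u: "continuous_on (cbox lo hi) u" "u \<in> cbox lo hi \<rightarrow> sphere (0::'n) 1"
    and uf: "\<And>x. x \<in> S \<Longrightarrow> u x = f x /\<^sub>R norm (f x)"
    by blast
  obtain l where l: "continuous_on (cbox lo hi) l" and lf: "\<And>x. x \<in> S \<Longrightarrow> l x = ln (norm (f x))"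
    by (rule Tietze_unbounded[OF cont(2) closed_subset[OF S(2,1)]]) (rule that)
  show thesis
  proof (rule that[of "\<lambda>x. exp (l x) *\<^sub>R u x"])
    show "continuous_on (cbox lo hi) (\<lambda>x. exp (l x) *\<^sub>R u x)"
      by (intro continuous_intros l u)
    show "exp (l x) *\<^sub>R u x \<noteq> 0" if "x \<in> cbox lo hi" for x
      using u(2) that by force
    show "exp (l x) *\<^sub>R u x = f x" if "x \<in> S" for x
      using nz that by (simp add: uf lf)
  qed
qed

text \<open>Here the dimension \<open>p\<close> of the target is a number and not a type. All but the first \<open>DIM('m) + 1\<close>
  coordinates are extended arbitrarily by Tietze's theorem. The remaining ones form a map into a
  Euclidean space of dimension \<open>DIM('m) + 1\<close>, and they only have to be kept from vanishing on the
  common zero set \<open>Z\<close> of the others, where \<open>extend_nonzero_map\<close> applies.\<close>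

lemma extend_nonzero_coordinates:
  fixes \<phi> :: "'m::euclidean_space \<Rightarrow> nat \<Rightarrow> real"
  assumes p: "DIM('m) < p" and S: "closed S" "S \<subseteq> cbox lo hi"
    and cont: "\<And>i. i < p \<Longrightarrow> continuous_on S (\<lambda>x. \<phi> x i)"
    and nz: "\<And>x. x \<in> S \<Longrightarrow> \<exists>i<p. \<phi> x i \<noteq> 0"
  obtains \<Phi> where "\<And>i. i < p \<Longrightarrow> continuous_on (cbox lo hi) (\<lambda>x. \<Phi> x i)"
    and "\<And>x. x \<in> cbox lo hi \<Longrightarrow> \<exists>i<p. \<Phi> x i \<noteq> 0"
    and "\<And>x i. \<lbrakk>x \<in> S; i < p\<rbrakk> \<Longrightarrow> \<Phi> x i = \<phi> x i"
proof -
  \<comment> \<open>The product with the real line serves as a type of dimension one more than that of the box.\<close>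
  define n where "n = DIM('m \<times> real)"
  have n: "n \<le> p" using p by (simp add: n_def)
  let ?B = "cbox lo hi"
  obtain e :: "'m \<times> real \<Rightarrow> nat" where e: "bij_betw e Basis {..<n}"
    using ex_bij_betw_finite_nat[of "Basis :: ('m \<times> real) set"] by (auto simp: n_def atLeast0LessThan)
  have ein: "e b < n" if "b \<in> Basis" for b using e that by (auto simp: bij_betw_def)
  have esurj: "\<exists>b\<in>Basis. e b = i" if "i < n" for i
    using e that by (metis bij_betw_imp_surj_on imageE lessThan_iff)
  have "\<forall>i. \<exists>v. i < p \<longrightarrow> continuous_on ?B v \<and> (\<forall>x\<in>S. v x = \<phi> x i)"
  proof
    fix i
    show "\<exists>v. i < p \<longrightarrow> continuous_on ?B v \<and> (\<forall>x\<in>S. v x = \<phi> x i)"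
    proof (cases "i < p")
      case True
      show ?thesis
        by (rule Tietze_unbounded[OF cont[OF True] closed_subset[OF S(2,1)]]) auto
    qed simp
  qed
  then obtain V where V: "\<And>i. i < p \<Longrightarrow> continuous_on ?B (V i)" "\<And>i x. \<lbrakk>i < p; x \<in> S\<rbrakk> \<Longrightarrow> V i x = \<phi> x i"
    by metis
  define Z where "Z = ?B \<inter> (\<Inter>i\<in>{n..<p}. {x\<in>?B. V i x = 0})"
  have Z: "closed Z" "Z \<subseteq> ?B"
    unfolding Z_def using V(1) by (auto intro!: closed_Int closed_INT continuous_closed_preimage_constant)
  define u where "u x = (\<Sum>b\<in>Basis. \<phi> x (e b) *\<^sub>R b)" for x
  have ub: "u x \<bullet> b = \<phi> x (e b)" if "b \<in> Basis" for x b
    unfolding u_def using that by (rule inner_sum_left_Basis)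
  have u: "continuous_on S u"
    unfolding u_def
  proof (intro continuous_intros cont)
    show "e b < p" if "b \<in> Basis" for b using ein[OF that] n by linarith
  qed
  have unz: "u x \<noteq> 0" if x: "x \<in> S \<inter> Z" for x
  proof -
    obtain i where i: "i < p" "\<phi> x i \<noteq> 0" using nz[of x] x by auto
    have "\<not> n \<le> i" using i x V(2)[of i x] by (auto simp: Z_def)
    then obtain b where "b \<in> Basis" "e b = i" using esurj[of i] by auto
    then show ?thesis using ub[of b x] i by auto
  qed
  obtain g where g: "continuous_on ?B g" "\<And>x. x \<in> ?B \<Longrightarrow> g x \<noteq> 0" "\<And>x. x \<in> S \<inter> Z \<Longrightarrow> g x = u x"
    by (rule extend_nonzero_map[of "S \<inter> Z" lo hi u])
      (use S Z unz u in \<open>auto intro: continuous_on_subset\<close>)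
  have "continuous_on (S \<union> Z) (\<lambda>x. if x \<in> S then u x else g x)"
    using S Z u g by (intro continuous_on_cases) (auto intro: continuous_on_subset)
  moreover have "closedin (top_of_set ?B) (S \<union> Z)" using S Z by (intro closed_subset) auto
  ultimately
  obtain W where W: "continuous_on ?B W" "\<And>x. x \<in> S \<union> Z \<Longrightarrow> W x = (if x \<in> S then u x else g x)"
    by (rule Tietze_unbounded) (rule that)
  define \<Phi> where "\<Phi> x i = (if i < n then W x \<bullet> the_inv_into Basis e i else V i x)" for x i
  have \<Phi>e: "\<Phi> x (e b) = W x \<bullet> b" if "b \<in> Basis" for x b
    using that ein e by (simp add: \<Phi>_def the_inv_into_f_f bij_betw_def)
  have \<Phi>S: "\<Phi> x i = \<phi> x i" if "x \<in> S" "i < p" for x i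
  proof (cases "i < n")
    case True
    then obtain b where "b \<in> Basis" "e b = i" using esurj by blast
    then show ?thesis using \<Phi>e[of b x] W(2)[of x] ub[of b x] that by auto
  qed (use V that in \<open>simp add: \<Phi>_def\<close>)
  show thesis
  proof (rule that[of \<Phi>])
    show "continuous_on ?B (\<lambda>x. \<Phi> x i)" if "i < p" for i
      unfolding \<Phi>_def using V W that by (cases "i < n") (auto intro!: continuous_intros)
    show "\<exists>i<p. \<Phi> x i \<noteq> 0" if x: "x \<in> ?B" for x
    proof -
      consider "x \<in> S" | "x \<notin> S" "x \<in> Z" | "x \<notin> Z" by blast
      then show ?thesis
      proof cases
        case 1
        then show ?thesis using nz[of x] \<Phi>S by auto
      next
        case 2
        then have "W x \<noteq> 0" using W(2) g(2) x by auto
        then obtain b where "b \<in> Basis" "W x \<bullet> b \<noteq> 0" using euclidean_all_zero_iff by blast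
        then show ?thesis using \<Phi>e[of b x] ein[of b] n by (intro exI[of _ "e b"]) simp
      next
        case 3
        then obtain i where "n \<le> i" "i < p" "V i x \<noteq> 0" using x by (auto simp: Z_def)
        then show ?thesis by (intro exI[of _ i]) (simp add: \<Phi>_def)
      qed
    qed
  qed (use \<Phi>S in auto)
qed

section \<open>The vanishing homotopy groups\<close>

context cube_chart
begin

text \<open>On the boundary of the cylinder the homotopy is given: the spheroid at the bottom, the base
  point on the top and the sides. Its first block extends without zeros.\<close>

lemma null_homotopic_high_dimension:
  assumes p: "DIM('m) + 1 < p" and a: "a \<in> topspace (quasi_sphere p q)"
    and f: "f \<in> spheroids n (quasi_sphere p q) a"
  shows "spheroid_homotopic n (quasi_sphere p q) a f (\<lambda>_. a)"
proof -
  let ?S = "{0} \<times> Q \<union> ({1} \<times> Q \<union> {0..1} \<times> bd) :: (real \<times> 'm) set"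
  define \<phi> where "\<phi> w i = (if fst w = 0 then f (c (snd w)) i else a i)" for w :: "real \<times> 'm" and i
  have Qc: "closed Q" by (simp add: Q closed_cbox)
  have box: "{0..1::real} \<times> Q = cbox (0, lo) (1, hi)" by (simp add: cbox_Pair_eq Q)
  have cont: "continuous_on ?S (\<lambda>w. \<phi> w i)" for i
    unfolding \<phi>_def
  proof (rule continuous_on_cases)
    show "continuous_on ({0} \<times> Q) (\<lambda>w. f (c (snd w)) i)"
      using spheroid_coordinates(1)[OF f, of i]
      by (rule continuous_on_compose2[OF _ continuous_on_snd[OF continuous_on_id]]) auto
    show "\<forall>w::real \<times> 'm. w \<in> {0} \<times> Q \<and> fst w \<noteq> 0 \<or> w \<in> {1} \<times> Q \<union> {0..1} \<times> bd \<and> fst w = 0 \<longrightarrow> f (c (snd w)) i = a i"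
      using spheroid_coordinates(3)[OF f] by auto
  qed (use Qc bd in \<open>auto intro!: closed_Times\<close>)
  have nz: "\<exists>i<p. \<phi> w i \<noteq> 0" if "w \<in> ?S" for w
  proof (cases "fst w = 0")
    case True
    then have "snd w \<in> Q" using that bd(2) by auto
    then show ?thesis using True quasi_sphere_nonzero[OF spheroid_coordinates(2)[OF f]] by (simp add: \<phi>_def)
  qed (use quasi_sphere_nonzero[OF a] in \<open>simp add: \<phi>_def\<close>)
  have closed: "closed ?S" using Qc bd by (auto intro!: closed_Times)
  have sub: "?S \<subseteq> cbox (0, lo) (1, hi)" unfolding box[symmetric] using bd by auto
  have dim: "DIM(real \<times> 'm) < p" using p by simp
  obtain \<Phi> where \<Phi>: "\<And>i. i < p \<Longrightarrow> continuous_on (cbox (0, lo) (1, hi)) (\<lambda>w. \<Phi> w i)"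
      "\<And>w. w \<in> cbox (0, lo) (1, hi) \<Longrightarrow> \<exists>i<p. \<Phi> w i \<noteq> 0" "\<And>w i. \<lbrakk>w \<in> ?S; i < p\<rbrakk> \<Longrightarrow> \<Phi> w i = \<phi> w i"
    by (rule extend_nonzero_coordinates[OF dim closed sub cont nz]) (assumption, rule that)
  show ?thesis
  proof (rule spheroid_homotopicI[where \<Phi> = \<Phi>])
    show "\<exists>r>0. \<forall>i<p. \<Phi> (0, z) i = r * f (c z) i" if "z \<in> Q" for z
      using \<Phi>(3)[of "(0, z)"] that by (intro exI[of _ 1]) (simp add: \<phi>_def)
    show "\<exists>r>0. \<forall>i<p. \<Phi> (1, z) i = r * a i" if "z \<in> Q" for z
      using \<Phi>(3)[of "(1, z)"] that by (intro exI[of _ 1]) (simp add: \<phi>_def)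
    show "\<exists>r>0. \<forall>i<p. \<Phi> (t, z) i = r * a i" if "0 \<le> t" "t \<le> 1" "z \<in> bd" for t z
      using \<Phi>(3)[of "(t, z)"] that spheroid_coordinates(3)[OF f that(3)]
      by (intro exI[of _ 1]) (simp add: \<phi>_def)
    show "continuous_on ({0..1} \<times> Q) (\<lambda>w. \<Phi> w i)" if "i < p" for i
      unfolding box by (rule \<Phi>(1)[OF that])
    show "\<exists>i<p. \<Phi> w i \<noteq> 0" if "w \<in> {0..1} \<times> Q" for w
      using that unfolding box by (rule \<Phi>(2))
  qed (rule f const_in_spheroids[OF a])+
qed

text \<open>The first coordinate has no zero, hence has the sign of that of the base point on the
  connected cube, and the two can be joined by a segment that avoids zero.\<close>

lemma null_homotopic_dimension_1:
  assumes a: "a \<in> topspace (quasi_sphere 1 q)" and f: "f \<in> spheroids n (quasi_sphere 1 q) a"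
  shows "spheroid_homotopic n (quasi_sphere 1 q) a f (\<lambda>_. a)"
proof -
  define g where "g z = f (c z) 0 * a 0" for z
  have a0: "a 0 \<noteq> 0" using quasi_sphere_nonzero[OF a] by simp
  have cont: "continuous_on Q (\<lambda>z. f (c z) 0)" by (rule spheroid_coordinates(1)[OF f])
  have nz: "g z \<noteq> 0" if "z \<in> Q" for z
    using quasi_sphere_nonzero[OF spheroid_coordinates(2)[OF f that]] a0 by (simp add: g_def)
  have "connected Q" by (simp add: Q convex_connected)
  then have conn: "connected (g ` Q)"
    unfolding g_def by (intro connected_continuous_image continuous_intros cont)
  obtain z0 where z0: "z0 \<in> bd" using bd(3) by blast
  have pos: "g z > 0" if z: "z \<in> Q" for z
  proof (rule ccontr)
    assume "\<not> g z > 0"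
    moreover have "g z0 > 0" using a0 by (simp add: g_def spheroid_coordinates(3)[OF f z0] zero_less_mult_iff) linarith
    moreover have "z0 \<in> Q" using z0 bd by auto
    ultimately have "0 \<in> g ` Q"
      using connected_contains_Icc[OF conn, of "g z" "g z0"] z by (auto simp: subset_iff)
    then show False using nz by auto
  qed
  show ?thesis
  proof (rule spheroid_homotopicI[where \<Phi> = "\<lambda>w i. (1 - fst w) * f (c (snd w)) 0 + fst w * a 0"])
    show "continuous_on ({0..1} \<times> Q) (\<lambda>w. (1 - fst w) * f (c (snd w)) 0 + fst w * a 0)"
      by (intro continuous_intros continuous_on_compose2[OF cont continuous_on_snd[OF continuous_on_id]]) auto
    show "\<exists>i<1::nat. (1 - fst w) * f (c (snd w)) 0 + fst w * a 0 \<noteq> 0" if w: "w \<in> {0..1} \<times> Q" for w :: "real \<times> 'm"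
    proof -
      let ?t = "fst w"
      have t: "0 \<le> ?t" "?t \<le> 1" using w by auto
      have "0 < g (snd w)" "0 < a 0 * a 0" using pos w a0 by (auto simp: zero_less_mult_iff)
      then have "0 < (1 - ?t) * g (snd w) + ?t * (a 0 * a 0)"
        using t by (cases "?t = 0") (auto intro: add_nonneg_pos)
      also have "\<dots> = ((1 - ?t) * f (c (snd w)) 0 + ?t * a 0) * a 0"
        by (simp add: g_def algebra_simps)
      finally show ?thesis by (intro exI[of _ "0::nat"]) auto
    qed
    show "\<exists>r>0. \<forall>i<1. (1 - fst (t, z)) * f (c (snd (t, z))) 0 + fst (t, z) * a 0 = r * a i" if "z \<in> bd" for t z
      by (intro exI[of _ 1]) (simp add: spheroid_coordinates(3)[OF f that] algebra_simps)
    show "\<exists>r>0. \<forall>i<1. (1 - fst (0, z)) * f (c (snd (0, z))) 0 + fst (0, z) * a 0 = r * f (c z) i" for z :: 'm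
      by (intro exI[of _ 1]) simp
    show "\<exists>r>0. \<forall>i<1. (1 - fst (1, z)) * f (c (snd (1, z))) 0 + fst (1, z) * a 0 = r * a i" for z :: 'm
      by (intro exI[of _ 1]) simp
  qed (rule f const_in_spheroids[OF a])+
qed

end

text \<open>Two logarithms of the same number differ by a multiple of \<open>2\<pi>\<i>\<close>, so \<open>L\<close> has a discrete range.\<close>

lemma constant_of_constant_exp:
  fixes L :: "real \<Rightarrow> complex"
  assumes "continuous_on {0..1} L" and const: "\<And>s. s \<in> {0..1} \<Longrightarrow> exp (L s) = k" and s: "s \<in> {0..1}"
  shows "L s = L 0"
proof -
  have "L constant_on {0..1}"
  proof (rule continuous_discrete_range_constant)
    show "\<exists>e>0. \<forall>y. y \<in> {0..1} \<and> L y \<noteq> L x \<longrightarrow> e \<le> norm (L y - L x)" if x: "x \<in> {0..1}" for x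
    proof (intro exI[of _ "2 * pi"] conjI allI impI)
      fix y :: real assume y: "y \<in> {0..1} \<and> L y \<noteq> L x"
      then have "exp (L y) = exp (L x)" using const x by simp
      then obtain m :: int where m: "L y = L x + (of_int (2 * m) * pi) * \<i>" by (auto simp: exp_eq)
      have "m \<noteq> 0" using m y by auto
      then have "1 \<le> \<bar>real_of_int m\<bar>" by linarith
      then show "2 * pi \<le> norm (L y - L x)" by (simp add: m norm_mult abs_mult)
    qed simp
  qed (use assms in auto)
  then show ?thesis using s by (auto simp: constant_on_def)
qed

text \<open>The first block is a map of the square to the punctured plane and has a continuous logarithm
  \<open>L\<close>. On the boundary the map is constant, hence so is \<open>L\<close>, because the four edges are connected and
  meet in corners. A homotopy that is linear in \<open>L\<close> therefore fixes the boundary.\<close>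

lemma null_homotopic_square_in_plane:
  assumes a: "a \<in> topspace (quasi_sphere 2 q)" and f: "f \<in> spheroids 2 (quasi_sphere 2 q) a"
  shows "spheroid_homotopic 2 (quasi_sphere 2 q) a f (\<lambda>_. a)"
proof -
  let ?Q = "{0..1} \<times> {0..1} :: (real \<times> real) set"
  let ?c = "\<lambda>(s, t) i. if i = 0 then s else if i = 1 then t else 0 :: real"
  define u where "u z = Complex (f (?c z) 0) (f (?c z) 1)" for z
  define A where "A = Complex (a 0) (a 1)"
  have ubd: "u z = A" if "z \<in> square_boundary" for z
    by (simp add: u_def A_def square.spheroid_coordinates(3)[OF f that])
  have cont: "continuous_on ?Q u"
    unfolding u_def Complex_eq by (intro continuous_intros square.spheroid_coordinates(1)[OF f])
  have nz: "u z \<noteq> 0" if "z \<in> ?Q" for z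
    using quasi_sphere_nonzero[OF square.spheroid_coordinates(2)[OF f that]]
    by (auto simp: u_def complex_eq_iff less_2_cases_iff)
  have "contractible ?Q" by (intro convex_imp_contractible convex_Times) auto
  then obtain L where L: "continuous_on ?Q L" "\<And>z. z \<in> ?Q \<Longrightarrow> u z = exp (L z)"
    using continuous_logarithm_on_contractible[OF cont _ nz] by metis
  have edge: "L (g s) = L (g 0)"
    if g: "continuous_on {0..1} g" and gbd: "\<And>s. s \<in> {0..1} \<Longrightarrow> g s \<in> square_boundary" and s: "s \<in> {0..1}"
    for g :: "real \<Rightarrow> real \<times> real" and s
  proof (rule constant_of_constant_exp[where k = A])
    have gQ: "g ` {0..1} \<subseteq> ?Q" using gbd by fastforce
    show "continuous_on {0..1} (\<lambda>s. L (g s))"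
      by (rule continuous_on_compose2[OF L(1) g gQ])
    show "exp (L (g s)) = A" if s: "s \<in> {0..1}" for s
    proof -
      have "g s \<in> ?Q" using gQ s by blast
      from L(2)[OF this] ubd[OF gbd[OF s]] show ?thesis by simp
    qed
  qed (rule s)
  have Lbd: "L z = L (0, 0)" if z: "z \<in> square_boundary" for z
  proof -
    have "L (s, 0) = L (0, 0)" "L (0, s) = L (0, 0)" "L (s, 1) = L (0, 1)" "L (1, s) = L (1, 0)"
      if "s \<in> {0..1}" for s
      using edge[of "\<lambda>s. (s, 0)" s] edge[of "\<lambda>s. (0, s)" s] edge[of "\<lambda>s. (s, 1)" s] edge[of "\<lambda>s. (1, s)" s] that
      by (simp_all add: continuous_on_Pair)
    note e = this
    have "L (1, 0) = L (0, 0)" "L (0, 1) = L (0, 0)" by (rule e; simp)+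
    note corners = this
    obtain s t where st: "z = (s, t)" by (cases z)
    then consider "s = 0" "t \<in> {0..1}" | "s = 1" "t \<in> {0..1}" | "t = 0" "s \<in> {0..1}" | "t = 1" "s \<in> {0..1}"
      using z by auto
    then show ?thesis
      by cases (simp_all only: st e(1)[of s] e(2)[of t] e(3)[of s] e(4)[of t] corners)
  qed
  define h where "h w = exp ((1 - of_real (fst w)) * L (snd w) + of_real (fst w) * L (0, 0))" for w :: "real \<times> real \<times> real"
  have exp0: "exp (L (0, 0)) = A" using L(2)[of "(0, 0)"] ubd[of "(0, 0)"] by simp
  show ?thesis
  proof (rule square.spheroid_homotopicI[where \<Phi> = "\<lambda>w i. if i = 0 then Re (h w) else Im (h w)"])
    have "continuous_on ({0..1} \<times> ?Q) h"
      unfolding h_def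
      by (intro continuous_intros continuous_on_compose2[OF L(1) continuous_on_snd[OF continuous_on_id]]) auto
    then show "continuous_on ({0..1} \<times> ?Q) (\<lambda>w. if i = 0 then Re (h w) else Im (h w))" for i :: nat
      by (cases "i = 0") (simp_all add: continuous_on_Re continuous_on_Im)
    show "\<exists>i<2::nat. (if i = 0 then Re (h w) else Im (h w)) \<noteq> 0" if "w \<in> {0..1} \<times> ?Q" for w
    proof -
      have "h w \<noteq> 0" by (simp add: h_def)
      then have "Re (h w) \<noteq> 0 \<or> Im (h w) \<noteq> 0" by (simp add: complex_eq_iff)
      then show ?thesis
      proof
        assume "Re (h w) \<noteq> 0" then show ?thesis by (intro exI[of _ "0::nat"]) simp
      next
        assume "Im (h w) \<noteq> 0" then show ?thesis by (intro exI[of _ "1::nat"]) simp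
      qed
    qed
    show "\<exists>r>0. \<forall>i<2. (if i = 0 then Re (h (0, z)) else Im (h (0, z))) = r * f (?c z) i" if "z \<in> ?Q" for z
      using L(2)[OF that, symmetric] by (intro exI[of _ 1]) (auto simp: h_def u_def less_2_cases_iff)
    show "\<exists>r>0. \<forall>i<2. (if i = 0 then Re (h (1, z)) else Im (h (1, z))) = r * a i" if "z \<in> ?Q" for z
      by (intro exI[of _ 1]) (auto simp: h_def exp0 A_def less_2_cases_iff)
    show "\<exists>r>0. \<forall>i<2. (if i = 0 then Re (h (t, z)) else Im (h (t, z))) = r * a i" if "z \<in> square_boundary" for t z
    proof -
      have "(1 - of_real t) * L (0, 0) + of_real t * L (0, 0) = L (0, 0)" by (simp add: algebra_simps)
      then have "h (t, z) = A" by (simp only: h_def Lbd[OF that] exp0 fst_conv snd_conv)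
      then show ?thesis by (intro exI[of _ 1]) (auto simp: A_def less_2_cases_iff)
    qed
  qed (rule f const_in_spheroids[OF a])+
qed

section \<open>Path components\<close>

lemma path_component_of_quasi_sphereI:
  fixes \<Phi> :: "real \<Rightarrow> nat \<Rightarrow> real"
  assumes x: "x \<in> topspace (quasi_sphere p q)" and y: "y \<in> topspace (quasi_sphere p q)"
    and cont: "\<And>i. i < p \<Longrightarrow> continuous_on {0..1} (\<lambda>t. \<Phi> t i)"
    and nz: "\<And>t. t \<in> {0..1} \<Longrightarrow> \<exists>i<p. \<Phi> t i \<noteq> 0"
    and ends: "\<And>i. i < p \<Longrightarrow> \<Phi> 0 i = x i" "\<And>i. i < p \<Longrightarrow> \<Phi> 1 i = y i"
  shows "path_component_of (quasi_sphere p q) x y"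
  unfolding path_component_of_def pathin_def
proof (intro exI conjI)
  let ?g = "\<lambda>t. quasi_point p q (\<Phi> t) (\<lambda>i. (1 - t) * x i + t * y i)"
  have "continuous_on {0..1} (\<lambda>t. (1 - t) * x i + t * y i)" for i
    by (intro continuous_intros)
  then show "continuous_map (top_of_set {0..1}) (quasi_sphere p q) ?g"
    by (intro continuous_map_quasi_point nz) (simp_all add: cont)
  show "?g 0 = x" "?g 1 = y"
    using ends by (auto intro!: quasi_point_eq x y exI[of _ 1])
qed

text \<open>Extending the two end points over a segment is the case of dimension one of the extension
  theorem; it requires at least two coordinates.\<close>

lemma path_connected_quasi_sphere:
  assumes "p \<ge> 2"
  shows "path_connected_space (quasi_sphere p q)"
  unfolding path_connected_space_iff_path_component
proof (intro ballI)
  fix x y assume x: "x \<in> topspace (quasi_sphere p q)" and y: "y \<in> topspace (quasi_sphere p q)"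
  define \<phi> where "\<phi> t = (if t = 0 then x else y)" for t :: real
  have cont: "continuous_on {0, 1} (\<lambda>t. \<phi> t i)" for i
    by (rule continuous_on_finite) simp
  have nz: "\<exists>i<p. \<phi> t i \<noteq> 0" for t
    using quasi_sphere_nonzero[OF x] quasi_sphere_nonzero[OF y] by (simp add: \<phi>_def)
  have S: "closed {0, 1::real}" "{0, 1::real} \<subseteq> cbox 0 1" "DIM(real) < p"
    using assms by auto
  obtain \<Phi> where \<Phi>: "\<And>i. i < p \<Longrightarrow> continuous_on (cbox 0 1) (\<lambda>t::real. \<Phi> t i)"
    "\<And>t. t \<in> cbox 0 1 \<Longrightarrow> \<exists>i<p. \<Phi> t i \<noteq> 0" "\<And>t i. \<lbrakk>t \<in> {0, 1}; i < p\<rbrakk> \<Longrightarrow> \<Phi> t i = \<phi> t i"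
    by (rule extend_nonzero_coordinates[OF S(3,1,2) cont nz]) (rule that)
  show "path_component_of (quasi_sphere p q) x y"
    using \<Phi>(1,2) \<Phi>(3)[of 0] \<Phi>(3)[of 1]
    by (intro path_component_of_quasi_sphereI[where \<Phi> = \<Phi>] x y) (simp_all add: \<phi>_def)
qed

lemma path_component_of_quasi_sphere_1:
  assumes x: "x \<in> topspace (quasi_sphere 1 q)" and y: "y \<in> topspace (quasi_sphere 1 q)"
  shows "path_component_of (quasi_sphere 1 q) x y \<longleftrightarrow> 0 < x 0 * y 0"
proof
  have nz: "z 0 \<noteq> 0" if "z \<in> topspace (quasi_sphere 1 q)" for z
    using quasi_sphere_nonzero[OF that] by simp
  assume "path_component_of (quasi_sphere 1 q) x y"
  then obtain g where g: "continuous_map (top_of_set {0..1::real}) (quasi_sphere 1 q) g" "g 0 = x" "g 1 = y"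
    unfolding path_component_of_def pathin_def by blast
  then have "continuous_on {0..1} (\<lambda>t. g t 0)" and gX: "\<And>t. t \<in> {0..1} \<Longrightarrow> g t \<in> topspace (quasi_sphere 1 q)"
    by (auto simp: continuous_map_into_quasi_sphere Pi_iff)
  then have cont: "continuous_on {0..1} (\<lambda>t. x 0 * g t 0)" by (intro continuous_intros)
  show "0 < x 0 * y 0"
  proof (rule ccontr)
    assume "\<not> 0 < x 0 * y 0"
    then have "\<exists>t\<ge>0. t \<le> 1 \<and> x 0 * g t 0 = 0"
      using cont by (intro IVT2') (auto simp: g)
    then show False using nz gX x by auto
  qed
next
  assume pos: "0 < x 0 * y 0"
  have nz: "(1 - t) * x 0 + t * y 0 \<noteq> 0" if t: "t \<in> {0..1}" for t
  proof -
    have "0 < (1 - t) * (x 0 * x 0) + t * (x 0 * y 0)"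
      using t pos by (cases "t = 0") (auto simp: zero_less_mult_iff intro!: add_nonneg_pos)
    also have "\<dots> = x 0 * ((1 - t) * x 0 + t * y 0)" by (simp add: algebra_simps)
    finally show ?thesis by auto
  qed
  have "continuous_on {0..1} (\<lambda>t. (1 - t) * x 0 + t * y 0)" by (intro continuous_intros)
  then show "path_component_of (quasi_sphere 1 q) x y"
    by (intro path_component_of_quasi_sphereI[where \<Phi> = "\<lambda>t i. (1 - t) * x 0 + t * y 0"] x y)
      (simp_all add: nz)
qed

lemma card_path_components_quasi_sphere_1: "card (path_components_of (quasi_sphere 1 q)) = 2"
proof -
  let ?X = "quasi_sphere 1 q"
  define e where "e k i = (if i = 0 then k else 0 :: real)" for k and i :: nat
  have e: "e 1 \<in> topspace ?X" "e (-1) \<in> topspace ?X"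
    by (auto simp: topspace_quasi_sphere e_def)
  have comp: "path_component_of_set ?X x = path_component_of_set ?X y" if "path_component_of ?X x y" for x y
    using that path_component_of_equiv by metis
  have "path_component_of_set ?X x \<in> {path_component_of_set ?X (e 1), path_component_of_set ?X (e (-1))}"
    if x: "x \<in> topspace ?X" for x
  proof -
    have "x 0 > 0 \<or> x 0 < 0" using quasi_sphere_nonzero[OF x] by auto
    then have "path_component_of ?X x (e 1) \<or> path_component_of ?X x (e (-1))"
      using path_component_of_quasi_sphere_1[OF x] e by (auto simp: e_def)
    then show ?thesis using comp by blast
  qed
  then have "path_components_of ?X \<subseteq> {path_component_of_set ?X (e 1), path_component_of_set ?X (e (-1))}"
    unfolding path_components_of_def by (intro image_subsetI)
  then have "path_components_of ?X = {path_component_of_set ?X (e 1), path_component_of_set ?X (e (-1))}"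
    using e by (auto simp: path_components_of_def)
  moreover have "path_component_of_set ?X (e 1) \<noteq> path_component_of_set ?X (e (-1))"
  proof
    assume eq: "path_component_of_set ?X (e 1) = path_component_of_set ?X (e (-1))"
    have "e (-1) \<in> path_component_of_set ?X (e (-1))" using e(2) by (simp add: path_component_of_refl)
    then have "path_component_of ?X (e 1) (e (-1))" unfolding eq[symmetric] by simp
    then show False using path_component_of_quasi_sphere_1[OF e] by (simp add: e_def)
  qed
  ultimately show ?thesis by simp
qed

section \<open>Loops in the punctured plane and the fundamental group\<close>

definition punctured_loop :: "complex \<Rightarrow> (real \<Rightarrow> complex) \<Rightarrow> bool"
  where "punctured_loop A \<gamma> \<longleftrightarrow> path \<gamma> \<and> 0 \<notin> path_image \<gamma> \<and> pathstart \<gamma> = A \<and> pathfinish \<gamma> = A"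

text \<open>The winding number of a loop is an integer but has complex type; the floor only recovers that
  integer.\<close>
definition loop_degree :: "(real \<Rightarrow> complex) \<Rightarrow> int"
  where "loop_degree \<gamma> = \<lfloor>Re (winding_number \<gamma> 0)\<rfloor>"

lemma of_int_loop_degree:
  assumes "punctured_loop A \<gamma>"
  shows "of_int (loop_degree \<gamma>) = winding_number \<gamma> 0"
proof -
  have "winding_number \<gamma> 0 \<in> \<int>"
    using assms by (intro integer_winding_number) (auto simp: punctured_loop_def)
  then show ?thesis by (auto simp: loop_degree_def Ints_def)
qed

lemma loop_degree_eq_iff:
  assumes \<gamma>: "punctured_loop A \<gamma>" and \<delta>: "punctured_loop A \<delta>"
  shows "loop_degree \<gamma> = loop_degree \<delta> \<longleftrightarrow> homotopic_paths (- {0}) \<gamma> \<delta>"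
proof -
  have "loop_degree \<gamma> = loop_degree \<delta> \<longleftrightarrow> winding_number \<gamma> 0 = winding_number \<delta> 0"
    unfolding of_int_loop_degree[OF \<gamma>, symmetric] of_int_loop_degree[OF \<delta>, symmetric] by simp
  also have "\<dots> \<longleftrightarrow> homotopic_paths (- {0}) \<gamma> \<delta>"
    using \<gamma> \<delta> by (intro winding_number_homotopic_paths_eq) (auto simp: punctured_loop_def)
  finally show ?thesis .
qed

lemma loop_degree_join:
  assumes \<gamma>: "punctured_loop A \<gamma>" and \<delta>: "punctured_loop A \<delta>"
  shows "punctured_loop A (\<gamma> +++ \<delta>)" and "loop_degree (\<gamma> +++ \<delta>) = loop_degree \<gamma> + loop_degree \<delta>"
proof -
  show join: "punctured_loop A (\<gamma> +++ \<delta>)"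
    using \<gamma> \<delta> by (auto simp: punctured_loop_def path_image_join)
  have "(of_int (loop_degree (\<gamma> +++ \<delta>)) :: complex) = of_int (loop_degree \<gamma> + loop_degree \<delta>)"
    using \<gamma> \<delta> unfolding of_int_add of_int_loop_degree[OF join] of_int_loop_degree[OF \<gamma>] of_int_loop_degree[OF \<delta>]
    by (intro winding_number_join) (auto simp: punctured_loop_def)
  then show "loop_degree (\<gamma> +++ \<delta>) = loop_degree \<gamma> + loop_degree \<delta>"
    unfolding of_int_eq_iff .
qed

lemma loop_of_degree:
  assumes "A \<noteq> 0"
  obtains \<gamma> where "punctured_loop A \<gamma>" "loop_degree \<gamma> = k"
proof
  define \<gamma> where "\<gamma> t = A * exp (2 * pi * \<i> * of_int k * of_real t)" for t
  have fin: "exp (2 * pi * \<i> * of_int k) = 1"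
    unfolding exp_eq_1 by (auto intro!: exI[of _ k])
  show loop: "punctured_loop A \<gamma>"
    unfolding punctured_loop_def path_def path_image_def pathstart_def pathfinish_def \<gamma>_def
    using assms fin by (auto intro!: continuous_intros)
  then have "path \<gamma>" "0 \<notin> path_image \<gamma>" by (auto simp: punctured_loop_def)
  then obtain l where l: "path l" "pathfinish l - pathstart l = 2 * of_real pi * \<i> * winding_number \<gamma> 0"
    "\<And>t. t \<in> {0..1} \<Longrightarrow> \<gamma> t = 0 + exp (l t)"
    by (rule winding_number_as_continuous_log) (rule that)
  define L where "L t = l t - 2 * pi * \<i> * of_int k * of_real t" for t
  have "L 1 = L 0"
  proof (rule constant_of_constant_exp[where k = A])
    show "continuous_on {0..1} L"
      unfolding L_def using l(1) by (intro continuous_intros) (simp add: path_def)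
    show "exp (L t) = A" if "t \<in> {0..1}" for t
      using l(3)[OF that, symmetric] by (simp add: L_def exp_diff \<gamma>_def)
  qed simp
  then have "2 * of_real pi * \<i> * winding_number \<gamma> 0 = 2 * pi * \<i> * of_int k"
    unfolding l(2)[symmetric] by (simp add: L_def pathfinish_def pathstart_def diff_eq_eq add.commute)
  then have "(of_int (loop_degree \<gamma>) :: complex) = of_int k"
    unfolding of_int_loop_degree[OF loop] by simp
  then show "loop_degree \<gamma> = k" unfolding of_int_eq_iff .
qed

lemma punctured_homotopyI:
  fixes h :: "real \<times> real \<Rightarrow> complex"
  assumes "continuous_on ({0..1} \<times> {0..1}) h" and nz: "\<And>w. w \<in> {0..1} \<times> {0..1} \<Longrightarrow> h w \<noteq> 0"
    and "\<And>s. s \<in> {0..1} \<Longrightarrow> h (0, s) = \<gamma> s" and "\<And>s. s \<in> {0..1} \<Longrightarrow> h (1, s) = \<delta> s"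
    and side: "\<And>t s. \<lbrakk>t \<in> {0..1}; s \<in> {0, 1}\<rbrakk> \<Longrightarrow> h (t, s) = A" and "punctured_loop A \<gamma>"
  shows "homotopic_paths (- {0}) \<gamma> \<delta>"
  unfolding homotopic_paths
proof (intro exI[of _ h] conjI ballI)
  show "h \<in> {0..1} \<times> {0..1} \<rightarrow> - {0}" using nz by blast
qed (use assms in \<open>simp_all add: punctured_loop_def pathstart_def pathfinish_def\<close>)

lemma punctured_homotopyE:
  assumes "homotopic_paths (- {0}) \<gamma> \<delta>" and \<gamma>: "punctured_loop A \<gamma>"
  obtains h :: "real \<times> real \<Rightarrow> complex"
  where "continuous_on ({0..1} \<times> {0..1}) h" and "\<And>w. w \<in> {0..1} \<times> {0..1} \<Longrightarrow> h w \<noteq> 0"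
    and "\<And>s. s \<in> {0..1} \<Longrightarrow> h (0, s) = \<gamma> s" and "\<And>s. s \<in> {0..1} \<Longrightarrow> h (1, s) = \<delta> s"
    and "\<And>t s. \<lbrakk>t \<in> {0..1}; s \<in> {0, 1}\<rbrakk> \<Longrightarrow> h (t, s) = A"
proof -
  obtain h :: "real \<times> real \<Rightarrow> complex" where h: "continuous_on ({0..1} \<times> {0..1}) h" "h \<in> ({0..1} \<times> {0..1}) \<rightarrow> - {0}"
    "\<forall>s\<in>{0..1}. h (0, s) = \<gamma> s" "\<forall>s\<in>{0..1}. h (1, s) = \<delta> s"
    "\<forall>t\<in>{0..1}. pathstart (h \<circ> Pair t) = pathstart \<gamma> \<and> pathfinish (h \<circ> Pair t) = pathfinish \<gamma>"
    using assms(1) unfolding homotopic_paths by blast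
  show thesis
  proof (rule that[of h])
    show "h w \<noteq> 0" if "w \<in> {0..1} \<times> {0..1}" for w using funcset_mem[OF h(2) that] by simp
    show "h (t, s) = A" if "t \<in> {0..1}" "s \<in> {0, 1}" for t s
      using bspec[OF h(5) that(1)] that(2) \<gamma> by (auto simp: punctured_loop_def pathstart_def pathfinish_def)
  qed (use h in blast)+
qed

text \<open>The first block turns a spheroid into a loop in the punctured plane, and conversely. Homotopies
  correspond as well, so that the winding number is a complete invariant.\<close>

lemma homotopy_group_plane:
  assumes a: "a \<in> topspace (quasi_sphere 2 q)"
  shows "homotopy_group 1 (quasi_sphere 2 q) a \<cong> integer_group"
proof -
  let ?X = "quasi_sphere 2 q" and ?c = "\<lambda>s i. if i = 0 then s else 0 :: real"
  define A where "A = Complex (a 0) (a 1)"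
  define loop where "loop f s = Complex (f (?c s) 0) (f (?c s) 1)" for f :: "(nat \<Rightarrow> real) \<Rightarrow> nat \<Rightarrow> real" and s
  have nz: "Complex (x 0) (x 1) \<noteq> 0" if "x \<in> topspace ?X" for x
    using quasi_sphere_nonzero[OF that] by (auto simp: complex_eq_iff less_2_cases_iff)
  have nzI: "\<exists>i<2::nat. (if i = 0 then Re z else Im z) \<noteq> 0" if "z \<noteq> 0" for z
  proof (cases "Re z = 0")
    case True
    with that show ?thesis by (intro exI[of _ "1::nat"]) (simp add: complex_eq_iff)
  qed (auto intro: exI[of _ "0::nat"])
  have loop: "punctured_loop A (loop f)" if f: "f \<in> spheroids 1 ?X a" for f
  proof -
    have "continuous_on {0..1} (loop f)"
      unfolding loop_def Complex_eq by (intro continuous_intros interval.spheroid_coordinates(1)[OF f])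
    moreover have "loop f s \<noteq> 0" if "s \<in> {0..1}" for s
      unfolding loop_def by (rule nz[OF interval.spheroid_coordinates(2)[OF f that]])
    moreover have "loop f 0 = A" "loop f 1 = A"
      unfolding loop_def A_def by (simp_all only: interval.spheroid_coordinates(3)[OF f] insert_iff simp_thms)
    ultimately show ?thesis
      by (auto simp: punctured_loop_def path_def path_image_def pathstart_def pathfinish_def)
  qed
  have fwd: "homotopic_paths (- {0}) (loop f) (loop g)" if fg: "spheroid_homotopic 1 ?X a f g" for f g
  proof -
    obtain H :: "real \<times> real \<Rightarrow> nat \<Rightarrow> real" where H: "\<And>i. continuous_on ({0..1} \<times> {0..1}) (\<lambda>w. H w i)"
      "\<And>w. w \<in> {0..1} \<times> {0..1} \<Longrightarrow> H w \<in> topspace ?X"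
      "\<And>s. s \<in> {0..1} \<Longrightarrow> H (0, s) = f (?c s)" "\<And>s. s \<in> {0..1} \<Longrightarrow> H (1, s) = g (?c s)"
      "\<And>t s. \<lbrakk>0 \<le> t; t \<le> 1; s \<in> {0, 1}\<rbrakk> \<Longrightarrow> H (t, s) = a"
      by (rule interval.spheroid_homotopicE[OF fg]) (rule that)
    let ?h = "\<lambda>w. Complex (H w 0) (H w 1)"
    show ?thesis
    proof (rule punctured_homotopyI[where h = ?h])
      show "continuous_on ({0..1} \<times> {0..1}) ?h"
        unfolding Complex_eq by (intro continuous_intros H(1))
      show "?h w \<noteq> 0" if "w \<in> {0..1} \<times> {0..1}" for w by (rule nz[OF H(2)[OF that]])
      show "?h (0, s) = loop f s" "?h (1, s) = loop g s" if "s \<in> {0..1}" for s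
        unfolding loop_def H(3)[OF that] H(4)[OF that] by (rule refl)+
      show "?h (t, s) = A" if "t \<in> {0..1}" "s \<in> {0, 1}" for t s
        using H(5)[of t s] that by (simp add: A_def)
      show "punctured_loop A (loop f)" using spheroid_homotopic_imp_spheroids[OF fg] loop by blast
    qed
  qed
  have bwd: "spheroid_homotopic 1 ?X a f g"
    if f: "f \<in> spheroids 1 ?X a" and g: "g \<in> spheroids 1 ?X a" and hom: "homotopic_paths (- {0}) (loop f) (loop g)" for f g
  proof -
    obtain h :: "real \<times> real \<Rightarrow> complex" where h: "continuous_on ({0..1} \<times> {0..1}) h" "\<And>w. w \<in> {0..1} \<times> {0..1} \<Longrightarrow> h w \<noteq> 0"
      "\<And>s. s \<in> {0..1} \<Longrightarrow> h (0, s) = loop f s" "\<And>s. s \<in> {0..1} \<Longrightarrow> h (1, s) = loop g s"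
      "\<And>t s. \<lbrakk>t \<in> {0..1}; s \<in> {0, 1}\<rbrakk> \<Longrightarrow> h (t, s) = A"
      by (rule punctured_homotopyE[OF hom loop[OF f]]) (rule that)
    show ?thesis
    proof (rule interval.spheroid_homotopicI[where \<Phi> = "\<lambda>w i. if i = 0 then Re (h w) else Im (h w)"])
      show "continuous_on ({0..1} \<times> {0..1}) (\<lambda>w. if i = 0 then Re (h w) else Im (h w))" for i :: nat
        using h(1) by (cases "i = 0") (simp_all add: continuous_on_Re continuous_on_Im)
      show "\<exists>i<2::nat. (if i = 0 then Re (h w) else Im (h w)) \<noteq> 0" if "w \<in> {0..1} \<times> {0..1}" for w
        by (rule nzI[OF h(2)[OF that]])
      show "\<exists>r>0. \<forall>i<2. (if i = 0 then Re (h (0, s)) else Im (h (0, s))) = r * f (?c s) i" if "s \<in> {0..1}" for s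
        using h(3) that by (intro exI[of _ 1]) (auto simp: loop_def less_2_cases_iff)
      show "\<exists>r>0. \<forall>i<2. (if i = 0 then Re (h (1, s)) else Im (h (1, s))) = r * g (?c s) i" if "s \<in> {0..1}" for s
        using h(4) that by (intro exI[of _ 1]) (auto simp: loop_def less_2_cases_iff)
      show "\<exists>r>0. \<forall>i<2. (if i = 0 then Re (h (t, s)) else Im (h (t, s))) = r * a i" if "0 \<le> t" "t \<le> 1" "s \<in> {0, 1}" for t s
        using h(5)[of t s] that by (intro exI[of _ 1]) (auto simp: A_def less_2_cases_iff)
    qed (rule f g)+
  qed
  show ?thesis
  proof (rule homotopy_group_iso_integer_groupI[where D = "\<lambda>f. loop_degree (loop f)"])
    show "spheroid_homotopic 1 ?X a f g \<longleftrightarrow> loop_degree (loop f) = loop_degree (loop g)"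
      if "f \<in> spheroids 1 ?X a" "g \<in> spheroids 1 ?X a" for f g
      using loop_degree_eq_iff[OF loop[OF that(1)] loop[OF that(2)]] fwd bwd[OF that] by blast
    show "loop_degree (loop (spheroid_concat f g)) = loop_degree (loop f) + loop_degree (loop g)"
      if f: "f \<in> spheroids 1 ?X a" and g: "g \<in> spheroids 1 ?X a" for f g
    proof -
      have upd: "(?c s)(0 := r) = ?c r" for s r by auto
      have "loop (spheroid_concat f g) = loop f +++ loop g"
        by (auto simp: loop_def spheroid_concat_def joinpaths_def fun_eq_iff upd)
      then show ?thesis using loop_degree_join(2)[OF loop[OF f] loop[OF g]] by simp
    qed
    show "\<exists>f\<in>spheroids 1 ?X a. loop_degree (loop f) = k" for k
    proof -
      have "A \<noteq> 0" unfolding A_def by (rule nz[OF a])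
      then obtain \<gamma> where \<gamma>: "punctured_loop A \<gamma>" "loop_degree \<gamma> = k" by (rule loop_of_degree)
      let ?\<Phi> = "\<lambda>s i. if i = 0 then Re (\<gamma> s) else Im (\<gamma> s)"
      have cont: "continuous_on {0..1} \<gamma>" and \<gamma>0: "\<And>s. s \<in> {0..1} \<Longrightarrow> \<gamma> s \<noteq> 0" and ends: "\<And>s. s \<in> {0, 1} \<Longrightarrow> \<gamma> s = A"
        using \<gamma>(1) by (auto simp: punctured_loop_def path_def path_image_def pathstart_def pathfinish_def)
      have c\<Phi>: "continuous_on {0..1} (\<lambda>s. ?\<Phi> s i)" for i :: nat
        using cont by (cases "i = 0") (simp_all add: continuous_on_Re continuous_on_Im)
      have side: "\<exists>r>0. \<forall>i<2. ?\<Phi> s i = r * a i" if "s \<in> {0, 1}" for s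
        unfolding ends[OF that] by (intro exI[of _ 1]) (auto simp: A_def less_2_cases_iff)
      obtain f where f: "f \<in> spheroids 1 ?X a"
        and dir: "\<And>s. s \<in> {0..1} \<Longrightarrow> \<exists>r>0. \<forall>i<2. f (?c s) i = r * ?\<Phi> s i"
        by (rule interval.spheroid_with_directions[OF a c\<Phi> nzI[OF \<gamma>0] side]) (assumption+, rule that)
      \<comment> \<open>The spheroid has the loop of degree \<open>k\<close> as its directions, but other lengths.\<close>
      have "homotopic_paths (- {0}) \<gamma> (loop f)"
      proof (rule homotopic_paths_linear)
        show "path \<gamma>" "path (loop f)" "pathstart (loop f) = pathstart \<gamma>" "pathfinish (loop f) = pathfinish \<gamma>"
          using \<gamma>(1) loop[OF f] by (auto simp: punctured_loop_def)
        show "closed_segment (\<gamma> s) (loop f s) \<subseteq> - {0}" if s: "s \<in> {0..1}" for s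
        proof -
          obtain r where r: "r > 0" "\<And>i. i < 2 \<Longrightarrow> f (?c s) i = r * ?\<Phi> s i" using dir[OF s] by auto
          then have eq: "loop f s = r *\<^sub>R \<gamma> s" by (simp add: loop_def complex_eq_iff)
          have "(1 - u) *\<^sub>R \<gamma> s + u *\<^sub>R r *\<^sub>R \<gamma> s \<noteq> 0" if u: "0 \<le> u" "u \<le> 1" for u
          proof -
            have "(1 - u) + u * r > 0" using u r(1) by (cases "u = 0") (auto intro: add_nonneg_pos)
            moreover have "(1 - u) *\<^sub>R \<gamma> s + u *\<^sub>R r *\<^sub>R \<gamma> s = ((1 - u) + u * r) *\<^sub>R \<gamma> s"
              by (simp add: algebra_simps)
            ultimately show ?thesis using \<gamma>0[OF s] by simp
          qed
          then have "0 \<notin> closed_segment (\<gamma> s) (r *\<^sub>R \<gamma> s)" unfolding in_segment(1) by metis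
          then show ?thesis unfolding eq by blast
        qed
      qed
      then show ?thesis
        using loop_degree_eq_iff[OF \<gamma>(1) loop[OF f]] \<gamma>(2) by (intro bexI[OF _ f]) simp
    qed
  qed simp
qed

section \<open>The Hopf map and its path lifting\<close>

text \<open>A vector \<open>u\<close> of \<open>\<real>\<^sup>3 = \<complex> \<times> \<real>\<close> acts on \<open>\<complex>\<^sup>2\<close> by the Pauli matrices, as the traceless Hermitian
  matrix with rows \<open>(r, c)\<close> and \<open>(cnj c, - r)\<close> for \<open>u = (c, r)\<close>. Its square is \<open>|u|\<^sup>2\<close>, so it has
  eigenvalues \<open>|u|\<close> and \<open>- |u|\<close>, each with a complex line of eigenvectors.\<close>
definition pauli :: "complex \<times> real \<Rightarrow> complex \<times> complex \<Rightarrow> complex \<times> complex"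
  where "pauli u v = (of_real (snd u) * fst v + fst u * snd v, cnj (fst u) * fst v - of_real (snd u) * snd v)"

text \<open>The nonzero eigenvectors for the eigenvalue \<open>|u|\<close> form the fibre of the Hopf map over the
  direction of \<open>u\<close>. Describing the fibre by this linear condition makes lifting a matter of linear
  projections.\<close>
definition spinor :: "complex \<times> real \<Rightarrow> complex \<times> complex \<Rightarrow> bool"
  where "spinor u v \<longleftrightarrow> v \<noteq> 0 \<and> pauli u v = norm u *\<^sub>R v"

text \<open>The orthogonal projection of \<open>\<complex>\<^sup>2\<close> onto the eigenline that is the fibre over \<open>u\<close>.\<close>
definition spinor_proj :: "complex \<times> real \<Rightarrow> complex \<times> complex \<Rightarrow> complex \<times> complex"
  where "spinor_proj u v = (1/2) *\<^sub>R (v + inverse (norm u) *\<^sub>R pauli u v)"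

definition hopf :: "complex \<times> complex \<Rightarrow> complex \<times> real"
  where "hopf v = (2 * fst v * cnj (snd v), (cmod (fst v))\<^sup>2 - (cmod (snd v))\<^sup>2)"

definition cscale :: "complex \<Rightarrow> complex \<times> complex \<Rightarrow> complex \<times> complex"
  where "cscale k v = (k * fst v, k * snd v)"

text \<open>The Hermitian product of \<open>w\<close> with \<open>v\<close>, normalised; this is the quotient of \<open>w\<close> by \<open>v\<close> if both lie on the
  same complex line, and it is continuous in both.\<close>
definition cratio :: "complex \<times> complex \<Rightarrow> complex \<times> complex \<Rightarrow> complex"
  where "cratio w v = (cnj (fst v) * fst w + cnj (snd v) * snd w) / of_real ((norm v)\<^sup>2)"

lemma norm_complex_real: "(norm (u :: complex \<times> real))\<^sup>2 = (cmod (fst u))\<^sup>2 + (snd u)\<^sup>2"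
  by (simp add: norm_prod_def)

lemma norm_complex_complex: "(norm (v :: complex \<times> complex))\<^sup>2 = (cmod (fst v))\<^sup>2 + (cmod (snd v))\<^sup>2"
  by (simp add: norm_prod_def)

lemma of_real_norm_complex_real:
  "of_real ((norm (u :: complex \<times> real))\<^sup>2) = fst u * cnj (fst u) + of_real (snd u) * of_real (snd u)"
  unfolding norm_complex_real of_real_add complex_norm_square by (simp add: power2_eq_square)

lemma of_real_norm_complex_complex:
  "of_real ((norm (v :: complex \<times> complex))\<^sup>2) = fst v * cnj (fst v) + snd v * cnj (snd v)"
  unfolding norm_complex_complex of_real_add complex_norm_square ..

lemma pauli_pauli: "pauli u (pauli u v) = (norm u)\<^sup>2 *\<^sub>R v"
  unfolding scaleR_prod_def scaleR_conv_of_real of_real_norm_complex_real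
  by (auto simp: pauli_def algebra_simps)

lemma pauli_diff: "pauli (u - w) v = pauli u v - pauli w v"
  by (auto simp: pauli_def algebra_simps)

lemma pauli_scaleR: "pauli u (r *\<^sub>R v) = r *\<^sub>R pauli u v" "pauli (r *\<^sub>R u) v = r *\<^sub>R pauli u v"
  by (auto simp: pauli_def algebra_simps scaleR_conv_of_real)

lemma pauli_add: "pauli u (v + w) = pauli u v + pauli u w"
  by (auto simp: pauli_def algebra_simps)

lemma pauli_cscale: "pauli u (cscale k v) = cscale k (pauli u v)"
  by (auto simp: pauli_def cscale_def algebra_simps)

lemma pauli_eigenvalue:
  assumes "v \<noteq> 0" "pauli u v = r *\<^sub>R v"
  shows "\<bar>r\<bar> = norm u"
proof -
  have "(norm u)\<^sup>2 *\<^sub>R v = r\<^sup>2 *\<^sub>R v"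
    unfolding pauli_pauli[symmetric] assms(2) pauli_scaleR by (simp add: power2_eq_square)
  then have "(norm u)\<^sup>2 = r\<^sup>2" using assms(1) by simp
  then have "norm u = r \<or> norm u = - r" by (simp add: power2_eq_iff)
  then show ?thesis using norm_ge_zero[of u] by linarith
qed

lemma spinor_spinor_proj:
  assumes "u \<noteq> 0" "spinor_proj u v \<noteq> 0"
  shows "spinor u (spinor_proj u v)"
proof -
  have "pauli u (spinor_proj u v) = norm u *\<^sub>R spinor_proj u v"
    using assms(1) unfolding spinor_proj_def pauli_scaleR pauli_add pauli_pauli
    by (simp add: power2_eq_square algebra_simps)
  then show ?thesis using assms(2) by (simp add: spinor_def)
qed

lemma spinor_proj_id:
  assumes "u \<noteq> 0" "spinor u v"
  shows "spinor_proj u v = v"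
  using assms by (simp add: spinor_proj_def spinor_def scaleR_half_double)

text \<open>A vector of the fibre over \<open>u\<close> that is killed by the projection for \<open>w\<close> is an eigenvector of \<open>w\<close>
  for \<open>- |w|\<close>, hence one of \<open>u - w\<close> for \<open>|u| + |w|\<close>. But the eigenvalues of \<open>u - w\<close> have absolute
  value \<open>|u - w|\<close>.\<close>

lemma spinor_proj_nonzero:
  assumes v: "spinor u v" and "w \<noteq> 0" and close: "norm (u - w) < norm u"
  shows "spinor_proj w v \<noteq> 0"
proof
  assume "spinor_proj w v = 0"
  then have "inverse (norm w) *\<^sub>R pauli w v = - v" by (simp add: spinor_proj_def eq_neg_iff_add_eq_0 add.commute)
  then have "norm w *\<^sub>R (inverse (norm w) *\<^sub>R pauli w v) = - (norm w *\<^sub>R v)" by simp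
  then have "pauli w v = - (norm w *\<^sub>R v)" using \<open>w \<noteq> 0\<close> by simp
  then have "pauli (u - w) v = (norm u + norm w) *\<^sub>R v"
    using v by (simp add: pauli_diff spinor_def scaleR_add_left)
  then have "\<bar>norm u + norm w\<bar> = norm (u - w)"
    using v by (intro pauli_eigenvalue) (auto simp: spinor_def)
  then show False using close norm_ge_zero[of w] norm_ge_zero[of u] by linarith
qed

text \<open>The two projected basis vectors cannot both vanish, because the trace of the projection is 1.\<close>

lemma spinor_exists:
  assumes "u \<noteq> 0"
  obtains v where "spinor u v"
proof (cases "spinor_proj u (1, 0) = 0")
  case False
  then show ?thesis using that spinor_spinor_proj[OF assms] by blast
next
  case True
  have "spinor_proj u (0, 1) \<noteq> 0"
  proof
    assume 0: "spinor_proj u (0, 1) = 0"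
    have "Re (fst (spinor_proj u (1, 0))) + Re (snd (spinor_proj u (0, 1))) = 1"
      by (simp add: spinor_proj_def pauli_def add_divide_distrib diff_divide_distrib)
    then show False using True 0 by simp
  qed
  then show ?thesis using that spinor_spinor_proj[OF assms] by blast
qed

lemma spinor_scaleR: "r > 0 \<Longrightarrow> spinor (r *\<^sub>R u) v \<longleftrightarrow> spinor u v"
  by (simp add: spinor_def pauli_scaleR flip: scaleR_scaleR)

lemma spinor_cscale: "\<lbrakk>spinor u v; k \<noteq> 0\<rbrakk> \<Longrightarrow> spinor u (cscale k v)"
  by (auto simp: spinor_def pauli_cscale) (auto simp: cscale_def prod_eq_iff)

lemma spinor_equations:
  assumes "spinor u v"
  shows "fst u * snd v = of_real (norm u - snd u) * fst v" "cnj (fst u) * fst v = of_real (norm u + snd u) * snd v"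
  using assms by (auto simp: spinor_def pauli_def prod_eq_iff scaleR_conv_of_real algebra_simps)

lemma spinor_collinear:
  assumes u: "u \<noteq> 0" and v: "spinor u v" and w: "spinor u w"
  shows "fst v * snd w = snd v * fst w"
proof (cases "fst u = 0")
  case False
  have "fst u * (fst v * snd w) = fst v * (fst u * snd w)" by simp
  also have "\<dots> = (of_real (norm u - snd u) * fst v) * fst w" unfolding spinor_equations(1)[OF w] by simp
  also have "\<dots> = fst u * (snd v * fst w)" unfolding spinor_equations(1)[OF v, symmetric] by simp
  finally show ?thesis using False by simp
next
  case True
  then have "norm u = \<bar>snd u\<bar>" "snd u \<noteq> 0" using u by (auto simp: norm_prod_def prod_eq_iff)
  then show ?thesis
    using spinor_equations[OF v] spinor_equations[OF w] True by (cases "snd u > 0") auto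
qed

text \<open>The fibre lies in a complex line, so any two of its elements have a quotient.\<close>

lemma cratio:
  assumes u: "u \<noteq> 0" and v: "spinor u v" and w: "spinor u w"
  shows "w = cscale (cratio w v) v" "cratio w v \<noteq> 0"
proof -
  let ?n = "of_real ((norm v)\<^sup>2) :: complex"
  have n: "?n \<noteq> 0" using v by (simp add: spinor_def)
  have nn: "?n = fst v * cnj (fst v) + snd v * cnj (snd v)" by (rule of_real_norm_complex_complex)
  note c = spinor_collinear[OF u v w]
  have "(cnj (fst v) * fst w + cnj (snd v) * snd w) * fst v = ?n * fst w"
    unfolding nn using c by (simp add: algebra_simps)
  moreover have "(cnj (fst v) * fst w + cnj (snd v) * snd w) * snd v = ?n * snd w"
    unfolding nn using c by (simp add: distrib_right mult.assoc)
  ultimately show eq: "w = cscale (cratio w v) v"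
    using n by (simp add: cscale_def cratio_def prod_eq_iff)
  show "cratio w v \<noteq> 0"
  proof
    assume "cratio w v = 0"
    then have "w = 0" using eq by (simp add: cscale_def prod_eq_iff)
    then show False using w by (simp add: spinor_def)
  qed
qed

lemma cratio_cscale: "v \<noteq> 0 \<Longrightarrow> cratio (cscale k v) v = k"
proof -
  assume "v \<noteq> 0"
  then have n: "(of_real ((norm v)\<^sup>2) :: complex) \<noteq> 0" by simp
  have "cnj (fst v) * (k * fst v) + cnj (snd v) * (k * snd v) = k * of_real ((norm v)\<^sup>2)"
    unfolding of_real_norm_complex_complex by (simp add: algebra_simps)
  then show ?thesis using n by (simp add: cratio_def cscale_def)
qed

lemma cscale_1 [simp]: "cscale 1 v = v"
  by (simp add: cscale_def)

lemma cratio_self: "v \<noteq> 0 \<Longrightarrow> cratio v v = 1"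
  using cratio_cscale[of v 1] by simp

lemma cratio_unique:
  assumes "v \<noteq> 0" "cscale k v = cscale l v"
  shows "k = l"
  using cratio_cscale[OF assms(1)] assms(2) by metis

lemma cscale_cscale: "cscale k (cscale l v) = cscale (k * l) v"
  by (simp add: cscale_def)

lemma norm_hopf: "norm (hopf v) = (norm v)\<^sup>2"
proof -
  have "(norm (hopf v))\<^sup>2 = ((norm v)\<^sup>2)\<^sup>2"
    unfolding norm_complex_real norm_complex_complex
    by (simp add: hopf_def norm_mult power_mult_distrib algebra_simps power2_eq_square)
  then show ?thesis by (rule power2_eq_imp_eq) auto
qed

lemma hopf_nonzero: "v \<noteq> 0 \<Longrightarrow> hopf v \<noteq> 0"
  using norm_hopf[of v] by auto

lemma spinor_hopf:
  assumes "v \<noteq> 0"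
  shows "spinor (hopf v) v"
proof -
  have "pauli (hopf v) v = (norm v)\<^sup>2 *\<^sub>R v"
    unfolding scaleR_prod_def scaleR_conv_of_real of_real_norm_complex_complex
    by (simp add: pauli_def hopf_def of_real_diff complex_norm_square algebra_simps del: of_real_power)
  then show ?thesis using assms by (simp add: spinor_def norm_hopf)
qed

lemma hopf_spinor:
  assumes u: "u \<noteq> 0" and v: "spinor u v"
  shows "\<exists>r>0. hopf v = r *\<^sub>R u"
proof (intro exI conjI)
  note e = spinor_equations[OF v]
  let ?n = "of_real (norm u) :: complex" and ?r = "of_real (snd u) :: complex" and ?z = "fst v" and ?w = "snd v"
  have e2: "fst u * cnj ?z = of_real (norm u + snd u) * cnj ?w"
    using arg_cong[OF e(2), of cnj] by simp
  have n: "?n \<noteq> 0" using u by simp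
  show "0 < (norm v)\<^sup>2 / norm u" using u v by (simp add: spinor_def)
  have 1: "fst u * of_real ((norm v)\<^sup>2) = 2 * ?n * (?z * cnj ?w)"
  proof -
    have "fst u * of_real ((norm v)\<^sup>2) = (fst u * cnj ?z) * ?z + (fst u * ?w) * cnj ?w"
      unfolding of_real_norm_complex_complex by (simp add: algebra_simps)
    also have "\<dots> = 2 * ?n * (?z * cnj ?w)" unfolding e(1) e2 by (simp add: algebra_simps)
    finally show ?thesis .
  qed
  have 2: "snd u * (norm v)\<^sup>2 = norm u * ((cmod ?z)\<^sup>2 - (cmod ?w)\<^sup>2)"
  proof -
    have "(fst u * ?w) * cnj ?z = (fst u * cnj ?z) * ?w" by (simp add: algebra_simps)
    then have "of_real (norm u - snd u) * (?z * cnj ?z) = of_real (norm u + snd u) * (?w * cnj ?w)"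
      unfolding e(1) e2 by (simp add: algebra_simps)
    then have "(of_real ((norm u - snd u) * (cmod ?z)\<^sup>2) :: complex) = of_real ((norm u + snd u) * (cmod ?w)\<^sup>2)"
      unfolding of_real_mult complex_norm_square .
    then have "(norm u - snd u) * (cmod ?z)\<^sup>2 = (norm u + snd u) * (cmod ?w)\<^sup>2"
      unfolding of_real_eq_iff .
    then show ?thesis unfolding norm_complex_complex by (simp add: algebra_simps)
  qed
  have "fst (hopf v) = fst (((norm v)\<^sup>2 / norm u) *\<^sub>R u)"
    using 1 n by (simp add: hopf_def scaleR_conv_of_real field_simps)
  moreover have "snd (hopf v) = snd (((norm v)\<^sup>2 / norm u) *\<^sub>R u)"
    using 2 u by (simp add: hopf_def field_simps)
  ultimately show "hopf v = ((norm v)\<^sup>2 / norm u) *\<^sub>R u" by (rule prod_eqI)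
qed

lemma continuous_on_spinor_proj:
  assumes "continuous_on S u" "continuous_on S v" "\<And>x. x \<in> S \<Longrightarrow> u x \<noteq> 0"
  shows "continuous_on S (\<lambda>x. spinor_proj (u x) (v x))"
  unfolding spinor_proj_def pauli_def using assms by (intro continuous_intros) auto

lemma continuous_on_hopf: "continuous_on S v \<Longrightarrow> continuous_on S (\<lambda>x. hopf (v x))"
  unfolding hopf_def by (intro continuous_intros)

lemma continuous_on_cratio:
  assumes "continuous_on S v" "continuous_on S w" "\<And>x. x \<in> S \<Longrightarrow> v x \<noteq> 0"
  shows "continuous_on S (\<lambda>x. cratio (w x) (v x))"
  unfolding cratio_def using assms by (intro continuous_intros) auto

lemma continuous_on_cscale:
  "\<lbrakk>continuous_on S k; continuous_on S v\<rbrakk> \<Longrightarrow> continuous_on S (\<lambda>x. cscale (k x) (v x))"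
  unfolding cscale_def by (intro continuous_intros)

text \<open>Follow \<open>u\<close> along the second variable in \<open>N\<close> equal steps, and in each step project the vector
  reached so far onto the next eigenline. If \<open>N\<close> is large, consecutive values of \<open>u\<close> are so close that
  no projection vanishes. As long as \<open>u\<close> stays at \<open>a\<close> the projections fix the vector \<open>e\<close>.\<close>

lemma hopf_lifting:
  fixes u :: "'k::euclidean_space \<times> real \<Rightarrow> complex \<times> real"
  assumes K: "compact K" and cont: "continuous_on (K \<times> {0..1}) u"
    and nz: "\<And>w. w \<in> K \<times> {0..1} \<Longrightarrow> u w \<noteq> 0"
    and start: "\<And>k. k \<in> K \<Longrightarrow> u (k, 0) = a" and e: "spinor a e"
  obtains F where "continuous_on (K \<times> {0..1}) F" "\<And>w. w \<in> K \<times> {0..1} \<Longrightarrow> spinor (u w) (F w)"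
    and "\<And>k t. \<lbrakk>k \<in> K; t \<in> {0..1}; \<forall>t'\<in>{0..t}. u (k, t') = a\<rbrakk> \<Longrightarrow> F (k, t) = e"
proof -
  let ?D = "K \<times> {0..1::real}"
  have D: "compact ?D" using K by (intro compact_Times) auto
  have "closed (u ` ?D)" using compact_continuous_image[OF cont D] compact_imp_closed by blast
  moreover have "0 \<notin> u ` ?D" using nz by force
  ultimately obtain \<delta> where "\<delta> > 0" "\<forall>x\<in>u ` ?D. \<delta> \<le> dist 0 x"
    using separate_point_closed by metis
  then have \<delta>: "\<delta> > 0" "\<And>w. w \<in> ?D \<Longrightarrow> \<delta> \<le> norm (u w)" by auto
  obtain \<eta> where \<eta>: "\<eta> > 0" "\<And>w w'. \<lbrakk>w \<in> ?D; w' \<in> ?D; dist w' w < \<eta>\<rbrakk> \<Longrightarrow> dist (u w') (u w) < \<delta>"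
    using compact_uniformly_continuous[OF cont D] \<delta>(1) unfolding uniformly_continuous_on_def by metis
  obtain N :: nat where N: "N > 0" "1 / N < \<eta>"
    using \<eta>(1) by (metis nat_approx_posE of_nat_0_less_iff zero_less_Suc)
  \<comment> \<open>The point reached after \<open>j\<close> of the \<open>N\<close> steps on the way to \<open>w\<close>.\<close>
  define pos where "pos j w = (fst w, real j * snd w / real N)" for j and w :: "'k \<times> real"
  define F where "F = rec_nat (\<lambda>w. e) (\<lambda>j G w. spinor_proj (u (pos (Suc j) w)) (G w))"
  have F0: "F 0 = (\<lambda>w. e)" and FSuc: "F (Suc j) = (\<lambda>w. spinor_proj (u (pos (Suc j) w)) (F j w))" for j
    by (simp_all add: F_def)
  have frac: "0 \<le> real j * t / N" "real j * t / N \<le> t" if "j \<le> N" "t \<in> {0..1}" for j t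
    using that N(1) by (auto simp: field_simps intro!: mult_left_mono)
  have pos: "pos j w \<in> ?D" if "j \<le> N" "w \<in> ?D" for j w
    using frac[of j "snd w"] that by (auto simp: pos_def)
  have upos: "continuous_on ?D (\<lambda>w. u (pos j w))" if "j \<le> N" for j
    by (rule continuous_on_compose2[OF cont]) (use N pos[OF that] in \<open>auto simp: pos_def intro!: continuous_intros\<close>)
  have step: "continuous_on ?D (F j) \<and> (\<forall>w\<in>?D. spinor (u (pos j w)) (F j w)) \<and>
      (\<forall>k\<in>K. \<forall>t\<in>{0..1}. (\<forall>t'\<in>{0..t}. u (k, t') = a) \<longrightarrow> F j (k, t) = e)" if "j \<le> N" for j
    using that
  proof (induction j)
    case 0
    then show ?case using start e by (auto simp: F0 pos_def)
  next
    case (Suc j)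
    then have IH: "continuous_on ?D (F j)" "\<And>w. w \<in> ?D \<Longrightarrow> spinor (u (pos j w)) (F j w)"
      "\<And>k t. \<lbrakk>k \<in> K; t \<in> {0..1}; \<forall>t'\<in>{0..t}. u (k, t') = a\<rbrakk> \<Longrightarrow> F j (k, t) = e"
      by auto
    have nzs: "u (pos (Suc j) w) \<noteq> 0" if "w \<in> ?D" for w by (rule nz[OF pos[OF Suc.prems that]])
    show ?case
    proof (intro conjI ballI impI)
      show "continuous_on ?D (F (Suc j))"
        unfolding FSuc by (intro continuous_on_spinor_proj upos Suc.prems IH(1) nzs)
    next
      fix w assume w: "w \<in> ?D"
      have "real (Suc j) * snd w / N - real j * snd w / N = snd w / N"
        unfolding diff_divide_distrib[symmetric] left_diff_distrib[symmetric] by simp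
      then have "dist (pos (Suc j) w) (pos j w) = \<bar>snd w / N\<bar>"
        unfolding pos_def dist_Pair_Pair dist_real_def by simp
      also have "\<dots> \<le> 1 / N" using w by (cases w) (simp add: divide_right_mono)
      also have "\<dots> < \<eta>" by (rule N(2))
      finally have "dist (pos j w) (pos (Suc j) w) < \<eta>" by (simp add: dist_commute)
      then have "dist (u (pos j w)) (u (pos (Suc j) w)) < \<delta>"
        using Suc.prems w by (intro \<eta>(2) pos) auto
      also have "\<delta> \<le> norm (u (pos j w))" using Suc.prems w by (intro \<delta>(2) pos) auto
      finally have "spinor_proj (u (pos (Suc j) w)) (F j w) \<noteq> 0"
        by (intro spinor_proj_nonzero[OF IH(2)[OF w] nzs[OF w]]) (simp add: dist_norm)
      then show "spinor (u (pos (Suc j) w)) (F (Suc j) w)"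
        unfolding FSuc by (rule spinor_spinor_proj[OF nzs[OF w]])
    next
      fix k t assume k: "k \<in> K" "t \<in> {0..1}" and const: "\<forall>t'\<in>{0..t}. u (k, t') = a"
      have "u (pos (Suc j) (k, t)) = a" using frac[OF Suc.prems k(2)] const by (simp add: pos_def)
      moreover have "a \<noteq> 0" using nzs[of "(k, t)"] k calculation by simp
      ultimately show "F (Suc j) (k, t) = e"
        unfolding FSuc IH(3)[OF k const] using e by (simp add: spinor_proj_id)
    qed
  qed
  have posN: "pos N w = w" for w using N(1) by (simp add: pos_def)
  note stepN = step[OF order.refl, unfolded posN]
  show thesis
  proof (rule that[of "F N"])
    show "continuous_on ?D (F N)" using stepN by (elim conjE)
    show "spinor (u w) (F N w)" if "w \<in> ?D" for w
      using stepN that by (elim conjE) (rule bspec)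
    show "F N (k, t) = e" if "k \<in> K" "t \<in> {0..1}" "\<forall>t'\<in>{0..t}. u (k, t') = a" for k t
      using stepN that by blast
  qed
qed

section \<open>The second homotopy group when p = 3\<close>

definition block :: "(nat \<Rightarrow> real) \<Rightarrow> complex \<times> real"
  where "block x = (Complex (x 0) (x 1), x 2)"

definition coord :: "complex \<times> real \<Rightarrow> nat \<Rightarrow> real"
  where "coord u i = (if i = 0 then Re (fst u) else if i = 1 then Im (fst u) else snd u)"

lemma less_3_cases: "i < 3 \<longleftrightarrow> i = 0 \<or> i = 1 \<or> i = (2::nat)"
  by auto

lemma coord_block: "i < 3 \<Longrightarrow> coord (r *\<^sub>R block x) i = r * x i"
  by (auto simp: coord_def block_def less_3_cases)

lemma block_coord: "(\<And>i. i < 3 \<Longrightarrow> x i = r * coord u i) \<Longrightarrow> block x = r *\<^sub>R u"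
  by (auto simp: coord_def block_def prod_eq_iff complex_eq_iff)

lemma coord_nonzero:
  assumes "u \<noteq> 0"
  shows "\<exists>i<3. coord u i \<noteq> 0"
proof (rule ccontr)
  assume "\<not> ?thesis"
  then have "coord u 0 = 0" "coord u 1 = 0" "coord u 2 = 0" by auto
  then have "u = 0" by (simp add: coord_def prod_eq_iff complex_eq_iff)
  then show False using assms by simp
qed

lemma continuous_on_coord: "continuous_on S u \<Longrightarrow> continuous_on S (\<lambda>x. coord (u x) i)"
  unfolding coord_def by (cases "i = 0"; cases "i = 1") (simp_all add: continuous_on_Re continuous_on_Im continuous_on_fst continuous_on_snd)

lemma continuous_on_block:
  assumes "\<And>i. continuous_on S (\<lambda>x. y x i)"
  shows "continuous_on S (\<lambda>x. block (y x))"
  unfolding block_def Complex_eq by (intro continuous_intros assms)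

lemma block_nonzero:
  assumes "x \<in> topspace (quasi_sphere 3 q)"
  shows "block x \<noteq> 0"
proof
  assume "block x = 0"
  then have "x 0 = 0" "x 1 = 0" "x 2 = 0" by (auto simp: block_def prod_eq_iff complex_eq_iff)
  then show False using quasi_sphere_nonzero[OF assms] by (auto simp: less_3_cases)
qed

abbreviation square_chart :: "real \<times> real \<Rightarrow> nat \<Rightarrow> real"
  where "square_chart \<equiv> \<lambda>(s, t) i. if i = 0 then s else if i = 1 then t else 0"

abbreviation open_box :: "(real \<times> real) set"
  where "open_box \<equiv> {0, 1} \<times> {0..1} \<union> {0..1} \<times> {0}"

text \<open>The vector \<open>e\<close> is a base point in the fibre over the base point \<open>a\<close>. Multiples of \<open>e\<close> identify that fibre
  with the punctured complex plane.\<close>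
locale hopf_fibre =
  fixes q :: nat and a :: "nat \<Rightarrow> real" and e :: "complex \<times> complex"
  assumes a: "a \<in> topspace (quasi_sphere 3 q)" and e: "spinor (block a) e"
begin

abbreviation "X \<equiv> quasi_sphere 3 q"

definition lifts :: "((nat \<Rightarrow> real) \<Rightarrow> nat \<Rightarrow> real) \<Rightarrow> (real \<times> real \<Rightarrow> complex \<times> complex) \<Rightarrow> bool"
  where "lifts f F \<longleftrightarrow> continuous_on ({0..1} \<times> {0..1}) F \<and>
    (\<forall>z\<in>{0..1} \<times> {0..1}. spinor (block (f (square_chart z))) (F z)) \<and> (\<forall>z\<in>open_box. F z = e)"

definition top_loop :: "(real \<times> real \<Rightarrow> complex \<times> complex) \<Rightarrow> real \<Rightarrow> complex"
  where "top_loop F s = cratio (F (s, 1)) e"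

lemma e0: "e \<noteq> 0"
  using e by (simp add: spinor_def)

lemma a0: "block a \<noteq> 0"
  by (rule block_nonzero[OF a])

lemma liftsD:
  assumes "lifts f F"
  shows "continuous_on ({0..1} \<times> {0..1}) F" and "z \<in> {0..1} \<times> {0..1} \<Longrightarrow> spinor (block (f (square_chart z))) (F z)"
    and "z \<in> {0..1} \<times> {0..1} \<Longrightarrow> F z \<noteq> 0" and "z \<in> open_box \<Longrightarrow> F z = e"
  using assms unfolding lifts_def spinor_def by blast+

text \<open>Lifting starts from the bottom side. It keeps the value \<open>e\<close> along the two vertical sides, since
  the spheroid is constant there.\<close>

lemma lifts_exists:
  assumes f: "f \<in> spheroids 2 X a"
  shows "\<exists>F. lifts f F"
proof -
  define u where "u z = block (f (square_chart z))" for z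
  have cont: "continuous_on ({0..1} \<times> {0..1}) u"
    unfolding u_def by (rule continuous_on_block[OF square.spheroid_coordinates(1)[OF f]])
  have nz: "u z \<noteq> 0" if "z \<in> {0..1} \<times> {0..1}" for z
    unfolding u_def by (rule block_nonzero[OF square.spheroid_coordinates(2)[OF f that]])
  have bd: "u z = block a" if "z \<in> square_boundary" for z
    unfolding u_def square.spheroid_coordinates(3)[OF f that] ..
  have start: "u (s, 0) = block a" if "s \<in> {0..1}" for s
    using that by (intro bd) simp
  have K: "compact {0..1::real}" by simp
  obtain F where F: "continuous_on ({0..1} \<times> {0..1}) F" "\<And>z. z \<in> {0..1} \<times> {0..1} \<Longrightarrow> spinor (u z) (F z)"
    and const: "\<And>s t. \<lbrakk>s \<in> {0..1}; t \<in> {0..1}; \<forall>t'\<in>{0..t}. u (s, t') = block a\<rbrakk> \<Longrightarrow> F (s, t) = e"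
    by (rule hopf_lifting[OF K cont nz start e]) (assumption+, rule that)
  have "F z = e" if z: "z \<in> open_box" for z
  proof -
    obtain s t where st: "z = (s, t)" "s \<in> {0..1}" "t \<in> {0..1}" using z by (cases z) fastforce
    show ?thesis unfolding st(1)
      by (rule const[OF st(2,3)], rule ballI, rule bd) (use z st in auto)
  qed
  then show ?thesis using F unfolding lifts_def u_def by blast
qed

lemma fibre_multiple:
  assumes "spinor (block a) v"
  shows "v = cscale (cratio v e) e" "cratio v e \<noteq> 0"
  using cratio[OF a0 e assms] by auto

lemma top_loop:
  assumes f: "f \<in> spheroids 2 X a" and F: "lifts f F"
  shows "punctured_loop 1 (top_loop F)"
    and "s \<in> {0..1} \<Longrightarrow> F (s, 1) = cscale (top_loop F s) e"
proof -
  have top: "spinor (block a) (F (s, 1))" if s: "s \<in> {0..1}" for s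
  proof -
    have "(s, 1) \<in> square_boundary" using s by simp
    from square.spheroid_coordinates(3)[OF f this] liftsD(2)[OF F, of "(s, 1)"] s
    show ?thesis by simp
  qed
  show "F (s, 1) = cscale (top_loop F s) e" if "s \<in> {0..1}"
    unfolding top_loop_def by (rule fibre_multiple[OF top[OF that]])
  have "continuous_on {0..1} (\<lambda>s. F (s, 1))"
    by (rule continuous_on_compose2[OF liftsD(1)[OF F]]) (simp_all add: continuous_on_Pair image_subset_iff)
  then have "continuous_on {0..1} (top_loop F)"
    unfolding top_loop_def by (intro continuous_on_cratio continuous_on_const e0)
  moreover have "top_loop F s \<noteq> 0" if "s \<in> {0..1}" for s
    unfolding top_loop_def by (rule fibre_multiple(2)[OF top[OF that]])
  moreover have "top_loop F 0 = 1" "top_loop F 1 = 1"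
    unfolding top_loop_def by (simp_all add: liftsD(4)[OF F] cratio_self e0)
  ultimately show "punctured_loop 1 (top_loop F)"
    by (auto simp: punctured_loop_def path_def path_image_def pathstart_def pathfinish_def)
qed

text \<open>The quotient of two lifts of the same spheroid is a map of the whole square to the punctured
  plane that is 1 on three sides. Its horizontal sections join the constant 1 to the quotient of the top loops.\<close>

lemma top_loop_unique:
  assumes f: "f \<in> spheroids 2 X a" and F: "lifts f F" and G: "lifts f G"
  shows "homotopic_paths (- {0}) (top_loop F) (top_loop G)"
proof (rule punctured_homotopyI)
  let ?h = "\<lambda>(t, s). cratio (G (s, t)) (F (s, t)) * top_loop F s"
  have swap: "continuous_on ({0..1} \<times> {0..1}) (\<lambda>w. M (snd w, fst w))"
    if "continuous_on ({0..1} \<times> {0..1}) M" for M :: "real \<times> real \<Rightarrow> complex \<times> complex"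
    by (rule continuous_on_compose2[OF that]) (auto intro!: continuous_on_Pair continuous_on_fst continuous_on_snd continuous_on_id)
  have ratio: "G z = cscale (cratio (G z) (F z)) (F z)" "cratio (G z) (F z) \<noteq> 0" if "z \<in> {0..1} \<times> {0..1}" for z
    using cratio[OF block_nonzero[OF square.spheroid_coordinates(2)[OF f that]] liftsD(2)[OF F that] liftsD(2)[OF G that]]
    by auto
  have loop: "continuous_on {0..1} (top_loop F)" "\<And>s. s \<in> {0..1} \<Longrightarrow> top_loop F s \<noteq> 0"
      "\<And>s. s \<in> {0, 1} \<Longrightarrow> top_loop F s = 1"
    using top_loop(1)[OF f F] by (auto simp: punctured_loop_def path_def path_image_def pathstart_def pathfinish_def)
  have "continuous_on ({0..1} \<times> {0..1}) (\<lambda>w. cratio (G (snd w, fst w)) (F (snd w, fst w)))"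
    using liftsD(3)[OF F] by (intro continuous_on_cratio swap liftsD(1)[OF F] liftsD(1)[OF G]) auto
  moreover have "continuous_on ({0..1} \<times> {0..1}) (\<lambda>w. top_loop F (snd w))"
    by (rule continuous_on_compose2[OF loop(1) continuous_on_snd[OF continuous_on_id]]) auto
  ultimately show "continuous_on ({0..1} \<times> {0..1}) ?h"
    unfolding case_prod_unfold by (rule continuous_on_mult)
  show "?h w \<noteq> 0" if "w \<in> {0..1} \<times> {0..1}" for w
    using that ratio(2)[of "(snd w, fst w)"] loop(2)[of "snd w"] by (cases w) simp
  show "?h (0, s) = top_loop F s" if "s \<in> {0..1}" for s
    using that by (simp add: liftsD(4)[OF F] liftsD(4)[OF G] cratio_self e0)
  show "?h (1, s) = top_loop G s" if s: "s \<in> {0..1}" for s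
  proof -
    have "G (s, 1) = cscale (cratio (G (s, 1)) (F (s, 1))) (cscale (top_loop F s) e)"
      using ratio(1)[of "(s, 1)"] s unfolding top_loop(2)[OF f F s, symmetric] by simp
    then have "cscale (top_loop G s) e = cscale (cratio (G (s, 1)) (F (s, 1)) * top_loop F s) e"
      unfolding top_loop(2)[OF f G s, symmetric] cscale_cscale .
    then show ?thesis using cratio_unique[OF e0] by simp
  qed
  show "?h (t, s) = 1" if "t \<in> {0..1}" "s \<in> {0, 1}" for t s
  proof -
    have "(s, t) \<in> open_box" using that by simp
    then show ?thesis using loop(3)[OF that(2)] by (simp add: liftsD(4)[OF F] liftsD(4)[OF G] cratio_self e0)
  qed
  show "punctured_loop 1 (top_loop F)" by (rule top_loop(1)[OF f F])
qed

text \<open>A homotopy lifts just like a spheroid, with the time of the homotopy as a further parameter. The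
  top side of its lift is a homotopy between the top loops of two particular lifts.\<close>

lemma top_loop_homotopic:
  assumes fg: "spheroid_homotopic 2 X a f g" and F: "lifts f F" and G: "lifts g G"
  shows "homotopic_paths (- {0}) (top_loop F) (top_loop G)"
proof -
  have f: "f \<in> spheroids 2 X a" and g: "g \<in> spheroids 2 X a"
    using spheroid_homotopic_imp_spheroids[OF fg] by auto
  obtain H :: "real \<times> real \<times> real \<Rightarrow> nat \<Rightarrow> real" where H: "\<And>i. continuous_on ({0..1} \<times> {0..1} \<times> {0..1}) (\<lambda>w. H w i)"
      "\<And>w. w \<in> {0..1} \<times> {0..1} \<times> {0..1} \<Longrightarrow> H w \<in> topspace X"
      "\<And>z. z \<in> {0..1} \<times> {0..1} \<Longrightarrow> H (0, z) = f (square_chart z)" "\<And>z. z \<in> {0..1} \<times> {0..1} \<Longrightarrow> H (1, z) = g (square_chart z)"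
      "\<And>t z. \<lbrakk>0 \<le> t; t \<le> 1; z \<in> square_boundary\<rbrakk> \<Longrightarrow> H (t, z) = a"
    by (rule square.spheroid_homotopicE[OF fg]) (rule that)
  let ?K = "{0..1} \<times> {0..1} :: (real \<times> real) set"
  define u where "u w = block (H (fst (fst w), snd (fst w), snd w))" for w :: "(real \<times> real) \<times> real"
  have "continuous_on (?K \<times> {0..1}) (\<lambda>w. H (fst (fst w), snd (fst w), snd w) i)" for i
    by (rule continuous_on_compose2[OF H(1)]) (auto intro!: continuous_on_Pair continuous_on_fst continuous_on_snd continuous_on_id)
  then have cont: "continuous_on (?K \<times> {0..1}) u"
    unfolding u_def by (rule continuous_on_block)
  have nz: "u w \<noteq> 0" if "w \<in> ?K \<times> {0..1}" for w
    unfolding u_def using that by (intro block_nonzero[OF H(2)]) auto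
  have bd: "u ((t, s), r) = block a" if "t \<in> {0..1}" "(s, r) \<in> square_boundary" for t s r
    unfolding u_def using that H(5)[of t "(s, r)"] by simp
  have start: "u (k, 0) = block a" if "k \<in> ?K" for k
    using that bd[of "fst k" "snd k" 0] by (cases k) simp
  have K: "compact ?K" by (intro compact_Times) auto
  obtain L where L: "continuous_on (?K \<times> {0..1}) L" "\<And>w. w \<in> ?K \<times> {0..1} \<Longrightarrow> spinor (u w) (L w)"
    and const: "\<And>k r. \<lbrakk>k \<in> ?K; r \<in> {0..1}; \<forall>r'\<in>{0..r}. u (k, r') = block a\<rbrakk> \<Longrightarrow> L (k, r) = e"
    by (rule hopf_lifting[OF K cont nz start e]) (assumption+, rule that)
  have Lbox: "L ((t, s), r) = e" if t: "t \<in> {0..1}" and z: "(s, r) \<in> open_box" for t s r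
  proof -
    have "(t, s) \<in> ?K" "r \<in> {0..1}" using t z by auto
    then show ?thesis by (rule const, intro ballI bd t) (use z in auto)
  qed
  have lift: "lifts f' (\<lambda>z. L ((t, fst z), snd z))"
    if t: "t \<in> {0..1}" and f': "\<And>z. z \<in> {0..1} \<times> {0..1} \<Longrightarrow> H (t, z) = f' (square_chart z)" for t f'
    unfolding lifts_def
  proof (intro conjI ballI)
    show "continuous_on ({0..1} \<times> {0..1}) (\<lambda>z. L ((t, fst z), snd z))"
      by (rule continuous_on_compose2[OF L(1)])
        (use t in \<open>auto intro!: continuous_on_Pair continuous_on_fst continuous_on_snd continuous_on_id\<close>)
    show "spinor (block (f' (square_chart z))) (L ((t, fst z), snd z))" if z: "z \<in> {0..1} \<times> {0..1}" for z
      using L(2)[of "((t, fst z), snd z)"] t z f'[OF z] by (auto simp: u_def)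
    show "L ((t, fst z), snd z) = e" if "z \<in> open_box" for z
      using that by (intro Lbox t) simp
  qed
  have lf: "lifts f (\<lambda>z. L ((0, fst z), snd z))" by (rule lift) (simp, rule H(3))
  have lg: "lifts g (\<lambda>z. L ((1, fst z), snd z))" by (rule lift) (simp, rule H(4))
  have "homotopic_paths (- {0}) (top_loop (\<lambda>z. L ((0, fst z), snd z))) (top_loop (\<lambda>z. L ((1, fst z), snd z)))"
  proof (rule punctured_homotopyI)
    let ?h = "\<lambda>w. cratio (L (w, 1)) e"
    have "continuous_on ({0..1} \<times> {0..1}) (\<lambda>w. L (w, 1))"
      by (rule continuous_on_compose2[OF L(1)]) (auto intro!: continuous_on_Pair continuous_on_id)
    then show "continuous_on ({0..1} \<times> {0..1}) ?h"
      by (intro continuous_on_cratio continuous_on_const e0)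
    show "?h w \<noteq> 0" if "w \<in> {0..1} \<times> {0..1}" for w
    proof (rule fibre_multiple(2))
      show "spinor (block a) (L (w, 1))"
        using L(2)[of "(w, 1)"] bd[of "fst w" "snd w" 1] that by (cases w) simp
    qed
    show "?h (t, s) = 1" if "t \<in> {0..1}" "s \<in> {0, 1}" for t s
    proof -
      have "L ((t, s), 1) = e" using that by (intro Lbox) simp_all
      then show ?thesis by (simp add: cratio_self e0)
    qed
    show "punctured_loop 1 (top_loop (\<lambda>z. L ((0, fst z), snd z)))" by (rule top_loop(1)[OF f lf])
  qed (simp_all add: top_loop_def)
  then show ?thesis
    using top_loop_unique[OF f F lf] top_loop_unique[OF g lg G] homotopic_paths_trans by blast
qed

text \<open>The two lifts and the homotopy of their top loops form a nowhere vanishing map \<open>\<psi>\<close> on the boundary of a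
  three-dimensional cube, with values in \<open>\<complex>\<^sup>2 = \<real>\<^sup>4\<close>. It extends to the cube, and the Hopf map
  sends the extension to a homotopy of the spheroids.\<close>

lemma homotopic_of_top_loop:
  assumes f: "f \<in> spheroids 2 X a" and g: "g \<in> spheroids 2 X a" and F: "lifts f F" and G: "lifts g G"
    and hom: "homotopic_paths (- {0}) (top_loop F) (top_loop G)"
  shows "spheroid_homotopic 2 X a f g"
proof -
  obtain h :: "real \<times> real \<Rightarrow> complex" where h: "continuous_on ({0..1} \<times> {0..1}) h" "\<And>w. w \<in> {0..1} \<times> {0..1} \<Longrightarrow> h w \<noteq> 0"
    "\<And>s. s \<in> {0..1} \<Longrightarrow> h (0, s) = top_loop F s" "\<And>s. s \<in> {0..1} \<Longrightarrow> h (1, s) = top_loop G s"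
    "\<And>t s. \<lbrakk>t \<in> {0..1}; s \<in> {0, 1}\<rbrakk> \<Longrightarrow> h (t, s) = 1"
    by (rule punctured_homotopyE[OF hom top_loop(1)[OF f F]]) (rule that)
  let ?Q = "{0..1} \<times> {0..1} :: (real \<times> real) set"
  let ?bottom = "{0::real} \<times> ?Q" and ?top = "{1::real} \<times> ?Q"
    and ?lid = "{0..1::real} \<times> {0..1::real} \<times> {1::real}" and ?box = "{0..1::real} \<times> open_box"
  let ?S = "?bottom \<union> (?top \<union> (?lid \<union> ?box)) :: (real \<times> real \<times> real) set"
  define \<psi>1 where "\<psi>1 w = (if snd (snd w) = 1 then cscale (h (fst w, fst (snd w))) e else e)" for w :: "real \<times> real \<times> real"
  define \<psi>2 where "\<psi>2 w = (if fst w = 1 then G (snd w) else \<psi>1 w)" for w :: "real \<times> real \<times> real"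
  define \<psi> where "\<psi> w = (if fst w = 0 then F (snd w) else \<psi>2 w)" for w :: "real \<times> real \<times> real"
  have closed: "closed ?bottom" "closed ?top" "closed ?lid" "closed ?box"
    by (auto intro!: closed_Times closed_Un)
  have c1: "continuous_on (?lid \<union> ?box) \<psi>1"
    unfolding \<psi>1_def
  proof (rule continuous_on_If)
    have "continuous_on ?lid (\<lambda>w. h (fst w, fst (snd w)))"
      by (rule continuous_on_compose2[OF h(1)]) (auto intro!: continuous_on_Pair continuous_on_fst continuous_on_snd continuous_on_id)
    then show "continuous_on ?lid (\<lambda>w. cscale (h (fst w, fst (snd w))) e)"
      by (intro continuous_on_cscale continuous_on_const)
    show "cscale (h (fst w, fst (snd w))) e = e" if "w \<in> ?box" "snd (snd w) = 1" for w
    proof -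
      have "h (fst w, fst (snd w)) = 1" using that by (intro h(5)) auto
      then show ?thesis by simp
    qed
    show "cscale (h (fst w, fst (snd w))) e = e" if "w \<in> ?lid" "snd (snd w) \<noteq> 1" for w
      using that by auto
  qed (use closed in simp_all)
  have c2: "continuous_on (?top \<union> (?lid \<union> ?box)) \<psi>2"
    unfolding \<psi>2_def
  proof (rule continuous_on_If)
    show "continuous_on ?top (\<lambda>w. G (snd w))"
      by (rule continuous_on_compose2[OF liftsD(1)[OF G] continuous_on_snd[OF continuous_on_id]]) auto
    show "G (snd w) = \<psi>1 w" if w: "w \<in> ?lid \<union> ?box" "fst w = 1" for w
    proof (cases "snd (snd w) = 1")
      case True
      then obtain s where s: "w = (1, s, 1)" "s \<in> {0..1}" using w by (cases w) auto
      then show ?thesis using top_loop(2)[OF g G s(2)] h(4)[OF s(2)] by (simp add: \<psi>1_def)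
    next
      case False
      then have "snd w \<in> open_box" using w by auto
      then show ?thesis using False liftsD(4)[OF G] by (simp add: \<psi>1_def)
    qed
    show "G (snd w) = \<psi>1 w" if "w \<in> ?top" "fst w \<noteq> 1" for w
      using that by auto
  qed (use closed c1 in \<open>simp_all only: closed_Un\<close>)
  have c3: "continuous_on ?S \<psi>"
    unfolding \<psi>_def
  proof (rule continuous_on_If)
    show "continuous_on ?bottom (\<lambda>w. F (snd w))"
      by (rule continuous_on_compose2[OF liftsD(1)[OF F] continuous_on_snd[OF continuous_on_id]]) auto
    show "F (snd w) = \<psi>2 w" if w: "w \<in> ?top \<union> (?lid \<union> ?box)" "fst w = 0" for w
    proof (cases "snd (snd w) = 1")
      case True
      then obtain s where s: "w = (0, s, 1)" "s \<in> {0..1}" using w by (cases w) auto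
      then show ?thesis using top_loop(2)[OF f F s(2)] h(3)[OF s(2)] by (simp add: \<psi>1_def \<psi>2_def)
    next
      case False
      then have "snd w \<in> open_box" using w by auto
      then show ?thesis using False w(2) liftsD(4)[OF F] by (simp add: \<psi>1_def \<psi>2_def)
    qed
    show "F (snd w) = \<psi>2 w" if "w \<in> ?bottom" "fst w \<noteq> 0" for w
      using that by auto
  qed (use closed c2 in \<open>simp_all only: closed_Un\<close>)
  have \<psi>F: "\<psi> (0, z) = F z" for z by (simp add: \<psi>_def)
  have \<psi>G: "\<psi> (1, z) = G z" for z by (simp add: \<psi>_def \<psi>2_def)
  have \<psi>side: "spinor (block a) (\<psi> (t, z))" if t: "t \<in> {0..1}" and z: "z \<in> square_boundary" for t z
  proof (cases "t = 0 \<or> t = 1")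
    case True
    have "z \<in> ?Q" using z by auto
    then show ?thesis
      using True liftsD(2)[OF F, of z] liftsD(2)[OF G, of z] square.spheroid_coordinates(3)[OF f z]
        square.spheroid_coordinates(3)[OF g z] \<psi>F \<psi>G by auto
  next
    case False
    then have "\<psi> (t, z) = \<psi>1 (t, z)" by (simp add: \<psi>_def \<psi>2_def)
    moreover have "spinor (block a) (cscale (h (t, fst z)) e)"
      using t z by (intro spinor_cscale e h(2)) auto
    ultimately show ?thesis using e by (simp add: \<psi>1_def)
  qed
  have nz: "\<psi> w \<noteq> 0" if w: "w \<in> ?S" for w
  proof -
    obtain t z where tz: "w = (t, z)" by (cases w)
    consider "t = 0" "z \<in> ?Q" | "t = 1" "z \<in> ?Q" | "t \<in> {0..1}" "z \<in> square_boundary" using w tz by auto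
    then show ?thesis
      by cases (use \<psi>F \<psi>G liftsD(3)[OF F] liftsD(3)[OF G] \<psi>side tz in \<open>simp_all add: spinor_def\<close>)
  qed
  have box: "{0..1::real} \<times> ?Q = cbox (0, 0, 0) (1, 1, 1 :: real)" by (simp add: cbox_Pair_eq)
  have "?S \<subseteq> {0..1::real} \<times> ?Q" by auto
  then have sub: "?S \<subseteq> cbox (0, 0, 0) (1, 1, 1)" unfolding box .
  have clS: "closed ?S" by (intro closed_Un closed)
  have dim: "DIM(real \<times> real \<times> real) < DIM(complex \<times> complex)" by simp
  obtain \<Psi> where \<Psi>: "continuous_on (cbox (0, 0, 0) (1, 1, 1)) \<Psi>" "\<And>w. w \<in> cbox (0, 0, 0) (1, 1, 1) \<Longrightarrow> \<Psi> w \<noteq> 0"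
      "\<And>w. w \<in> ?S \<Longrightarrow> \<Psi> w = \<psi> w"
    by (rule extend_nonzero_map[OF dim clS sub c3 nz]) (assumption, rule that)
  have dir: "\<exists>r>0. \<forall>i<3. coord (hopf (\<Psi> w)) i = r * x i"
    if w: "w \<in> ?S" and v: "spinor (block x) (\<psi> w)" and x: "x \<in> topspace X" for w x
  proof -
    obtain r where "r > 0" "hopf (\<Psi> w) = r *\<^sub>R block x"
      using hopf_spinor[OF block_nonzero[OF x] v] \<Psi>(3)[OF w] by auto
    then show ?thesis using coord_block by auto
  qed
  show ?thesis
  proof (rule square.spheroid_homotopicI[where \<Phi> = "\<lambda>w. coord (hopf (\<Psi> w))"])
    show "continuous_on ({0..1} \<times> ?Q) (\<lambda>w. coord (hopf (\<Psi> w)) i)" for i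
      unfolding box by (intro continuous_on_coord continuous_on_hopf \<Psi>(1))
    show "\<exists>i<3. coord (hopf (\<Psi> w)) i \<noteq> 0" if "w \<in> {0..1} \<times> ?Q" for w
      using that unfolding box by (intro coord_nonzero hopf_nonzero \<Psi>(2))
    show "\<exists>r>0. \<forall>i<3. coord (hopf (\<Psi> (0, z))) i = r * f (square_chart z) i" if z: "z \<in> ?Q" for z
      by (rule dir) (use z \<psi>F liftsD(2)[OF F z] square.spheroid_coordinates(2)[OF f z] in simp_all)
    show "\<exists>r>0. \<forall>i<3. coord (hopf (\<Psi> (1, z))) i = r * g (square_chart z) i" if z: "z \<in> ?Q" for z
      by (rule dir) (use z \<psi>G liftsD(2)[OF G z] square.spheroid_coordinates(2)[OF g z] in simp_all)
    show "\<exists>r>0. \<forall>i<3. coord (hopf (\<Psi> (t, z))) i = r * a i" if t: "0 \<le> t" "t \<le> 1" and z: "z \<in> square_boundary" for t z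
    proof (rule dir[OF _ \<psi>side a])
      show "(t, z) \<in> ?S" using t z by (cases z) auto
    qed (use t z in simp_all)
  qed (rule f g)+
qed

definition degree :: "((nat \<Rightarrow> real) \<Rightarrow> nat \<Rightarrow> real) \<Rightarrow> int"
  where "degree f = loop_degree (top_loop (SOME F. lifts f F))"

lemma degree_eq:
  assumes f: "f \<in> spheroids 2 X a" and F: "lifts f F"
  shows "degree f = loop_degree (top_loop F)"
proof -
  have G: "lifts f (SOME F. lifts f F)" by (rule someI[of "lifts f", OF F])
  show ?thesis
    unfolding degree_def
    using loop_degree_eq_iff[OF top_loop(1)[OF f G] top_loop(1)[OF f F]] top_loop_unique[OF f G F] by simp
qed

lemma degree_complete:
  assumes f: "f \<in> spheroids 2 X a" and g: "g \<in> spheroids 2 X a"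
  shows "spheroid_homotopic 2 X a f g \<longleftrightarrow> degree f = degree g"
proof -
  obtain F G where F: "lifts f F" and G: "lifts g G" using lifts_exists[OF f] lifts_exists[OF g] by blast
  have "degree f = degree g \<longleftrightarrow> homotopic_paths (- {0}) (top_loop F) (top_loop G)"
    unfolding degree_eq[OF f F] degree_eq[OF g G]
    by (rule loop_degree_eq_iff[OF top_loop(1)[OF f F] top_loop(1)[OF g G]])
  then show ?thesis
    using top_loop_homotopic[OF _ F G] homotopic_of_top_loop[OF f g F G] by blast
qed

text \<open>Lifts are equal to \<open>e\<close> on the vertical sides, so they can be placed side by side.\<close>

lemma degree_concat:
  assumes f: "f \<in> spheroids 2 X a" and g: "g \<in> spheroids 2 X a"
  shows "degree (spheroid_concat f g) = degree f + degree g"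
proof -
  obtain F G where F: "lifts f F" and G: "lifts g G" using lifts_exists[OF f] lifts_exists[OF g] by blast
  define M where "M z = (if fst z \<le> 1/2 then F (2 * fst z, snd z) else G (2 * fst z - 1, snd z))" for z :: "real \<times> real"
  have upd: "(square_chart (s, t))(0 := r) = square_chart (r, t)" for s t r by auto
  have fg: "spheroid_concat f g (square_chart (s, t)) =
      (if s \<le> 1/2 then f (square_chart (2 * s, t)) else g (square_chart (2 * s - 1, t)))" for s t
    unfolding spheroid_concat_def upd by simp
  have "lifts (spheroid_concat f g) M"
    unfolding lifts_def
  proof (intro conjI ballI)
    let ?L = "{0..1/2} \<times> {0..1} :: (real \<times> real) set" and ?R = "{1/2..1} \<times> {0..1} :: (real \<times> real) set"
    have "continuous_on (?L \<union> ?R) M"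
      unfolding M_def
    proof (rule continuous_on_If)
      show "continuous_on ?L (\<lambda>z. F (2 * fst z, snd z))"
        by (rule continuous_on_compose2[OF liftsD(1)[OF F]])
          (auto intro!: continuous_on_Pair continuous_on_mult continuous_on_fst continuous_on_snd continuous_on_id continuous_on_const)
      show "continuous_on ?R (\<lambda>z. G (2 * fst z - 1, snd z))"
        by (rule continuous_on_compose2[OF liftsD(1)[OF G]])
          (auto intro!: continuous_on_Pair continuous_on_diff continuous_on_mult continuous_on_fst continuous_on_snd continuous_on_id continuous_on_const)
      have mid: "F (2 * fst z, snd z) = G (2 * fst z - 1, snd z)" if "fst z = 1/2" "snd z \<in> {0..1}" for z
        using that by (simp add: liftsD(4)[OF F] liftsD(4)[OF G])
      show "F (2 * fst z, snd z) = G (2 * fst z - 1, snd z)" if "z \<in> ?L" "\<not> fst z \<le> 1/2" for z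
        using that by auto
      show "F (2 * fst z, snd z) = G (2 * fst z - 1, snd z)" if "z \<in> ?R" "fst z \<le> 1/2" for z
        using that by (intro mid) auto
    qed (intro closed_Times; simp)+
    moreover have "?L \<union> ?R = {0..1} \<times> {0..1}" by auto
    ultimately show "continuous_on ({0..1} \<times> {0..1}) M" by simp
  next
    fix z :: "real \<times> real" assume "z \<in> {0..1} \<times> {0..1}"
    then obtain s t where st: "z = (s, t)" "0 \<le> s" "s \<le> 1" "0 \<le> t" "t \<le> 1" by (cases z) auto
    show "spinor (block (spheroid_concat f g (square_chart z))) (M z)"
      unfolding st(1) fg
      using liftsD(2)[OF F, of "(2 * s, t)"] liftsD(2)[OF G, of "(2 * s - 1, t)"] st by (simp add: M_def)
  next
    fix z :: "real \<times> real" assume z: "z \<in> open_box"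
    then obtain s t where st: "z = (s, t)" "0 \<le> s" "s \<le> 1" by (cases z) auto
    have "(2 * s, t) \<in> open_box" if "s \<le> 1/2" using that z st by auto
    moreover have "(2 * s - 1, t) \<in> open_box" if "\<not> s \<le> 1/2" using that z st by auto
    ultimately show "M z = e" unfolding st(1) M_def by (simp add: liftsD(4)[OF F] liftsD(4)[OF G])
  qed
  moreover have "top_loop M = top_loop F +++ top_loop G"
    by (simp add: top_loop_def M_def joinpaths_def fun_eq_iff)
  ultimately have "degree (spheroid_concat f g) = loop_degree (top_loop F +++ top_loop G)"
    using degree_eq[OF spheroid_concat_in_spheroids[OF _ f g]] by simp
  then show ?thesis
    unfolding degree_eq[OF f F] degree_eq[OF g G]
    using loop_degree_join(2)[OF top_loop(1)[OF f F] top_loop(1)[OF g G]] by simp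
qed

text \<open>A loop of degree \<open>k\<close> on the top side and \<open>e\<close> on the three other sides extend without zeros to the
  square. The image of the extension under the Hopf map is a spheroid that has the extension as its lift.\<close>

lemma degree_surjective: "\<exists>f\<in>spheroids 2 X a. degree f = k"
proof -
  obtain \<gamma> where \<gamma>: "punctured_loop 1 \<gamma>" "loop_degree \<gamma> = k" by (rule loop_of_degree[OF one_neq_zero])
  have \<gamma>c: "continuous_on {0..1} \<gamma>" and \<gamma>0: "\<And>s. s \<in> {0..1} \<Longrightarrow> \<gamma> s \<noteq> 0" and \<gamma>1: "\<And>s. s \<in> {0, 1} \<Longrightarrow> \<gamma> s = 1"
    using \<gamma>(1) by (auto simp: punctured_loop_def path_def path_image_def pathstart_def pathfinish_def)
  let ?Q = "{0..1} \<times> {0..1} :: (real \<times> real) set" and ?lid = "{0..1} \<times> {1} :: (real \<times> real) set"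
  define \<psi> where "\<psi> z = (if snd z = 1 then cscale (\<gamma> (fst z)) e else e)" for z :: "real \<times> real"
  have bd: "square_boundary = ?lid \<union> open_box" by auto
  have closed: "closed ?lid" "closed open_box" by (intro closed_Un closed_Times; simp)+
  have cont: "continuous_on square_boundary \<psi>"
    unfolding bd \<psi>_def
  proof (rule continuous_on_If)
    have "continuous_on ?lid (\<lambda>z. \<gamma> (fst z))"
      by (rule continuous_on_compose2[OF \<gamma>c continuous_on_fst[OF continuous_on_id]]) auto
    then show "continuous_on ?lid (\<lambda>z. cscale (\<gamma> (fst z)) e)"
      by (intro continuous_on_cscale continuous_on_const)
    show "cscale (\<gamma> (fst z)) e = e" if "z \<in> open_box" "snd z = 1" for z
    proof -
      have "\<gamma> (fst z) = 1" using that by (intro \<gamma>1) auto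
      then show ?thesis by simp
    qed
    show "cscale (\<gamma> (fst z)) e = e" if "z \<in> ?lid" "snd z \<noteq> 1" for z
      using that by auto
  qed (use closed in simp_all)
  have spin: "spinor (block a) (\<psi> z)" if "z \<in> square_boundary" for z
  proof (cases "snd z = 1")
    case True
    then have "\<gamma> (fst z) \<noteq> 0" using that by (intro \<gamma>0) auto
    then show ?thesis using True spinor_cscale[OF e] by (simp add: \<psi>_def)
  qed (simp add: \<psi>_def e)
  have nz: "\<psi> z \<noteq> 0" if "z \<in> square_boundary" for z
    using spin[OF that] by (simp add: spinor_def)
  have box: "?Q = cbox (0, 0) (1, 1 :: real)" by (simp add: cbox_Pair_eq)
  have "square_boundary \<subseteq> ?Q" by auto
  then have sub: "square_boundary \<subseteq> cbox (0, 0) (1, 1)" unfolding box .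
  have cl: "closed square_boundary" unfolding bd by (intro closed_Un[of ?lid] closed)
  have dim: "DIM(real \<times> real) < DIM(complex \<times> complex)" by simp
  obtain \<Psi> where \<Psi>: "continuous_on (cbox (0, 0) (1, 1)) \<Psi>" "\<And>z. z \<in> cbox (0, 0) (1, 1) \<Longrightarrow> \<Psi> z \<noteq> 0"
      "\<And>z. z \<in> square_boundary \<Longrightarrow> \<Psi> z = \<psi> z"
    by (rule extend_nonzero_map[OF dim cl sub cont nz]) (assumption, rule that)
  have dcont: "continuous_on ?Q (\<lambda>z. coord (hopf (\<Psi> z)) i)" for i
    unfolding box by (intro continuous_on_coord continuous_on_hopf \<Psi>(1))
  have dnz: "\<exists>i<3. coord (hopf (\<Psi> z)) i \<noteq> 0" if "z \<in> ?Q" for z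
    using that unfolding box by (intro coord_nonzero hopf_nonzero \<Psi>(2))
  have dside: "\<exists>r>0. \<forall>i<3. coord (hopf (\<Psi> z)) i = r * a i" if z: "z \<in> square_boundary" for z
  proof -
    obtain r where "r > 0" "hopf (\<Psi> z) = r *\<^sub>R block a"
      using hopf_spinor[OF a0 spin[OF z]] \<Psi>(3)[OF z] by auto
    then show ?thesis using coord_block by auto
  qed
  obtain f where f: "f \<in> spheroids 2 X a"
    and dir: "\<And>z. z \<in> ?Q \<Longrightarrow> \<exists>r>0. \<forall>i<3. f (square_chart z) i = r * coord (hopf (\<Psi> z)) i"
    by (rule square.spheroid_with_directions[OF a dcont dnz dside]) (assumption+, rule that)
  have "lifts f \<Psi>"
    unfolding lifts_def
  proof (intro conjI ballI)
    show "continuous_on ?Q \<Psi>" unfolding box by (rule \<Psi>(1))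
    show "spinor (block (f (square_chart z))) (\<Psi> z)" if z: "z \<in> ?Q" for z
    proof -
      obtain r where r: "r > 0" "\<And>i. i < 3 \<Longrightarrow> f (square_chart z) i = r * coord (hopf (\<Psi> z)) i"
        using dir[OF z] by auto
      have "block (f (square_chart z)) = r *\<^sub>R hopf (\<Psi> z)" by (rule block_coord[OF r(2)])
      moreover have "spinor (hopf (\<Psi> z)) (\<Psi> z)" using z unfolding box by (intro spinor_hopf \<Psi>(2))
      ultimately show ?thesis using spinor_scaleR[OF r(1)] by simp
    qed
    show "\<Psi> z = e" if z: "z \<in> open_box" for z
    proof -
      have "\<Psi> z = \<psi> z" using z by (intro \<Psi>(3)) (auto simp: bd)
      also have "\<dots> = e"
      proof (cases "snd z = 1")
        case True
        then have "\<gamma> (fst z) = 1" using z by (intro \<gamma>1) auto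
        then show ?thesis by (simp add: \<psi>_def)
      qed (simp add: \<psi>_def)
      finally show ?thesis .
    qed
  qed
  then have "degree f = loop_degree (top_loop \<Psi>)" by (rule degree_eq[OF f])
  moreover have "homotopic_paths (- {0}) \<gamma> (top_loop \<Psi>)"
  proof (rule homotopic_paths_eq)
    show "path \<gamma>" "path_image \<gamma> \<subseteq> - {0}" using \<gamma>(1) by (auto simp: punctured_loop_def)
    show "\<gamma> s = top_loop \<Psi> s" if "s \<in> {0..1}" for s
      using that by (simp add: top_loop_def \<Psi>(3) \<psi>_def cratio_cscale e0)
  qed
  ultimately have "degree f = k"
    using \<gamma> loop_degree_eq_iff[OF \<gamma>(1) top_loop(1)[OF f \<open>lifts f \<Psi>\<close>]] by simp
  then show ?thesis using f by (rule bexI)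
qed

lemma homotopy_group_space: "homotopy_group 2 X a \<cong> integer_group"
  by (rule homotopy_group_iso_integer_groupI[where D = degree])
    (simp_all add: degree_complete degree_surjective degree_concat)

end

theorem mainTheorem2:
  fixes p q :: nat
  assumes "p \<ge> 1"
  shows "(p \<noteq> 1 \<longrightarrow> path_connected_space (quasi_sphere p q)) \<and>
         (p = 1 \<longrightarrow> card (path_components_of (quasi_sphere p q)) = 2) \<and>
         (\<forall>a \<in> topspace (quasi_sphere p q).
            (p \<noteq> 2 \<longrightarrow> trivial_group (homotopy_group 1 (quasi_sphere p q) a)) \<and>
            (p = 2 \<longrightarrow> homotopy_group 1 (quasi_sphere p q) a \<cong> integer_group)) \<and>
         (\<forall>a \<in> topspace (quasi_sphere p q).
            (p \<noteq> 3 \<longrightarrow> trivial_group (homotopy_group 2 (quasi_sphere p q) a)) \<and>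
            (p = 3 \<longrightarrow> homotopy_group 2 (quasi_sphere p q) a \<cong> integer_group))"
proof (intro conjI impI ballI)
  show "path_connected_space (quasi_sphere p q)" if "p \<noteq> 1"
    using assms that by (intro path_connected_quasi_sphere) simp
  show "card (path_components_of (quasi_sphere p q)) = 2" if "p = 1"
    unfolding that by (rule card_path_components_quasi_sphere_1)
next
  fix a assume a: "a \<in> topspace (quasi_sphere p q)"
  show "trivial_group (homotopy_group 1 (quasi_sphere p q) a)" if p: "p \<noteq> 2"
  proof (rule trivial_homotopy_groupI[OF _ a])
    fix f assume f: "f \<in> spheroids 1 (quasi_sphere p q) a"
    consider "p = 1" | "DIM(real) + 1 < p" using assms p by fastforce
    then show "spheroid_homotopic 1 (quasi_sphere p q) a f (\<lambda>_. a)"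
    proof cases
      case 1
      then show ?thesis using a f interval.null_homotopic_dimension_1 by blast
    next
      case 2
      then show ?thesis by (rule interval.null_homotopic_high_dimension[OF _ a f])
    qed
  qed simp
  show "homotopy_group 1 (quasi_sphere p q) a \<cong> integer_group" if "p = 2"
    using a unfolding that by (rule homotopy_group_plane)
  show "trivial_group (homotopy_group 2 (quasi_sphere p q) a)" if p: "p \<noteq> 3"
  proof (rule trivial_homotopy_groupI[OF _ a])
    fix f assume f: "f \<in> spheroids 2 (quasi_sphere p q) a"
    consider "p = 1" | "p = 2" | "DIM(real \<times> real) + 1 < p" using assms p by fastforce
    then show "spheroid_homotopic 2 (quasi_sphere p q) a f (\<lambda>_. a)"
    proof cases
      case 1
      then show ?thesis using a f square.null_homotopic_dimension_1 by blast
    next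
      case 2
      then show ?thesis using a f null_homotopic_square_in_plane by blast
    next
      case 3
      then show ?thesis by (rule square.null_homotopic_high_dimension[OF _ a f])
    qed
  qed simp
  show "homotopy_group 2 (quasi_sphere p q) a \<cong> integer_group" if p: "p = 3"
  proof -
    have a3: "a \<in> topspace (quasi_sphere 3 q)" using a unfolding p .
    obtain e where "spinor (block a) e" by (rule spinor_exists[OF block_nonzero[OF a3]])
    then interpret hopf_fibre q a e using a3 by unfold_locales
    show ?thesis unfolding p by (rule homotopy_group_space)
  qed
qed

end
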